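(* Let $X$ be a separable Banach space, $D$ a closed, bounded and convex subset of $X$, and $\tau$ a locally convex topology on $D$ containing the weak topology on $D$. Suppose $D$ is $\tau$-strongly regular but fails the $\tau$-convex point of continuity property. Then there is a nonempty closed convex subset of $D$ without extreme points; that is, $D$ fails the Krein-Milman property.
   Context: Locally convex means having a basis of convex open sets. For $C\subset D$, $\tau|_C$ is the induced topology. $D$ has the $\tau$-convex point of continuity property ($\tau$-CPCP) if for every bounded convex $C\subset D$ and every $\varepsilon>0$ there is a nonempty $\tau|_C$-open set of diameter less than $\varepsilon$. $D$ is $\tau$-strongly regular if for every bounded convex $C\subset D$ and every $\varepsilon>0$ there is a convex combination (Minkowski sum $\sum_i\lambda_iU_i$, $\lambda_i\ge0$, $\sum\lambda_i=1$) of nonempty $\tau|_C$-open sets $U_i$ with diameter less than $\varepsilon$. $D$ has the Krein-Milman property if every nonempty closed convex subset of $D$ has an extreme point. *)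

theory Defs
  imports "HOL-Analysis.Analysis"
begin

definition weak_topology_on :: "'a::real_normed_vector set \<Rightarrow> 'a topology" where
  "weak_topology_on D =
     topology_generated_by {D \<inter> f -` U | f U. bounded_linear (f :: 'a \<Rightarrow> real) \<and> open U}"

definition locally_convex_top :: "'a::real_vector topology \<Rightarrow> bool" where
  "locally_convex_top T \<longleftrightarrow>
     (\<forall>U x. openin T U \<and> x \<in> U \<longrightarrow> (\<exists>V. openin T V \<and> convex V \<and> x \<in> V \<and> V \<subseteq> U))"

definition tau_CPCP :: "'a::real_normed_vector topology \<Rightarrow> 'a set \<Rightarrow> bool" where
  "tau_CPCP T D \<longleftrightarrow>
     (\<forall>C. C \<subseteq> D \<and> C \<noteq> {} \<and> bounded C \<and> convex C \<longrightarrow>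
        (\<forall>\<epsilon>>0. \<exists>U. openin (subtopology T C) U \<and> U \<noteq> {} \<and> diameter U < \<epsilon>))"

definition convex_comb_sets :: "nat \<Rightarrow> (nat \<Rightarrow> real) \<Rightarrow> (nat \<Rightarrow> 'a::real_vector set) \<Rightarrow> 'a set" where
  "convex_comb_sets n l U = {(\<Sum>i<n. l i *\<^sub>R x i) | x. \<forall>i<n. x i \<in> U i}"

definition tau_strongly_regular :: "'a::real_normed_vector topology \<Rightarrow> 'a set \<Rightarrow> bool" where
  "tau_strongly_regular T D \<longleftrightarrow>
     (\<forall>C. C \<subseteq> D \<and> C \<noteq> {} \<and> bounded C \<and> convex C \<longrightarrow>
        (\<forall>\<epsilon>>0. \<exists>n l U. (\<forall>i<n. l i \<ge> 0) \<and> (\<Sum>i<n. l i) = 1 \<and>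
           (\<forall>i<n. openin (subtopology T C) (U i) \<and> U i \<noteq> {}) \<and>
           diameter (convex_comb_sets n l U) < \<epsilon>))"

definition krein_milman_property :: "'a::real_normed_vector set \<Rightarrow> bool" where
  "krein_milman_property D \<longleftrightarrow>
     (\<forall>K. K \<subseteq> D \<and> K \<noteq> {} \<and> closed K \<and> convex K \<longrightarrow> (\<exists>x. x extreme_point_of K))"

end

theory Submission
  imports Defs
begin

text \<open>
  Let \<open>C \<subseteq> D\<close> be convex with all nonempty relatively \<open>\<tau>\<close>-open subsets of diameter at least \<open>\<epsilon>\<close>.
  In \<open>C\<close> one grows a finitely branching tree of convex relatively open sets \<open>U\<^sub>\<alpha>\<close>, children being
  subsets of their parents, and takes \<open>K\<close> to be the intersection over all levels of the closed
  convex hull of the sets of that level. Strong regularity provides weights on the tree along which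
  the diameter of \<open>\<Sum> \<lambda>\<^sub>\<alpha> U\<^sub>\<alpha>\<close> tends to \<open>0\<close>, so \<open>K\<close> is nonempty.

  Separability and the Hahn-Banach theorem allow the sets of a level to be shrunk so that, for a
  prescribed small ball \<open>B\<close> and every probability weight \<open>c\<close>, either \<open>\<Sum> c\<^sub>\<alpha> U\<^sub>\<alpha>\<close> has small diameter
  or it stays away from \<open>B\<close>; all balls of a countable base are treated in turn. A point \<open>x\<close> of \<open>K\<close>
  determines, by compactness, a coherent system of weights \<open>c\<close> with \<open>x\<close> in the closure of
  \<open>\<Sum> c\<^sub>\<alpha> U\<^sub>\<alpha>\<close> at every level, and these sums must then have diameters tending to \<open>0\<close>. Smallness of
  the diameter is inherited by smaller weights, so the part of \<open>x\<close> below any node converges in norm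
  and \<open>x\<close> is a convex combination of points of \<open>K\<close> in the closures of the \<open>U\<^sub>\<alpha>\<close> with \<open>c\<^sub>\<alpha> > 0\<close>.
  If \<open>x\<close> were extreme, it would lie in the closure of a single \<open>U\<^sub>\<alpha>\<close>; then the unit weight at \<open>\<alpha>\<close>
  would also have to be small, contradicting that \<open>U\<^sub>\<alpha>\<close> has diameter at least \<open>\<epsilon>\<close>.
\<close>

section \<open>Norming functionals\<close>

definition sublinear :: "('a::real_vector \<Rightarrow> real) \<Rightarrow> bool" where
  "sublinear q \<longleftrightarrow> (\<forall>x y. q (x + y) \<le> q x + q y) \<and> (\<forall>t x. 0 \<le> t \<longrightarrow> q (t *\<^sub>R x) = t * q x)"

text \<open>For a positive factor the reverse inequality is the same one for \<open>1/t\<close> at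
  \<open>t *\<^sub>R x\<close>. Infima of functionals therefore have to be estimated from one side
  only.\<close>

lemma sublinearI:
  fixes q :: "'a::real_vector \<Rightarrow> real"
  assumes add: "\<And>x y. q (x + y) \<le> q x + q y" and zero: "q 0 = 0"
    and scale: "\<And>t x. 0 < t \<Longrightarrow> q (t *\<^sub>R x) \<le> t * q x"
  shows "sublinear q"
  unfolding sublinear_def
proof (intro conjI allI impI)
  fix t :: real and x assume "0 \<le> t"
  show "q (t *\<^sub>R x) = t * q x"
  proof (cases "t = 0")
    case False
    with \<open>0 \<le> t\<close> have t: "0 < t" by simp
    have "q ((1/t) *\<^sub>R (t *\<^sub>R x)) \<le> (1/t) * q (t *\<^sub>R x)" using t by (intro scale) simp
    then have "t * q x \<le> q (t *\<^sub>R x)" using t by (simp add: field_simps)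
    with scale[OF t, of x] show ?thesis by simp
  qed (simp add: zero)
qed (rule add)

lemma sublinear_ge:
  assumes "sublinear q"
  shows "- q (- x) \<le> q x"
proof -
  have "q (0 *\<^sub>R x) = 0 * q x" using assms unfolding sublinear_def by blast
  moreover have "q (x + (- x)) \<le> q x + q (- x)" using assms unfolding sublinear_def by blast
  ultimately show ?thesis by simp
qed

text \<open>Take \<open>r x\<close> as the infimum of \<open>q (x + t *\<^sub>R y) - t * q y\<close>
  over \<open>t \<ge> 0\<close>; subadditivity bounds it below by \<open>- q (- x)\<close>. The
  value at \<open>t = 0\<close> gives \<open>r x \<le> q x\<close>, and the value at
  \<open>t = 1\<close> gives the bound at \<open>- y\<close>.\<close>

lemma sublinear_tilt:
  fixes q :: "'a::real_vector \<Rightarrow> real"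
  assumes q: "sublinear q"
  obtains r where "sublinear r" "\<And>x. r x \<le> q x" "r (- y) \<le> - q y"
proof
  define g where "g x t = q (x + t *\<^sub>R y) - t * q y" for x t
  define r where "r x = (INF t\<in>{0..}. g x t)" for x
  have qadd: "q (x + z) \<le> q x + q z" for x z using q unfolding sublinear_def by blast
  have qscale: "0 \<le> t \<Longrightarrow> q (t *\<^sub>R x) = t * q x" for t x using q unfolding sublinear_def by blast
  have q0: "q 0 = 0" using qscale[of 0 0] by simp
  have low: "- q (- x) \<le> g x t" if "t \<ge> 0" for x t
    using qadd[of "x + t *\<^sub>R y" "- x"] qscale[OF that, of y] by (simp add: g_def)
  have bdd: "bdd_below (g x ` {0..})" for x
    using low by (intro bdd_belowI[of _ "- q (- x)"]) auto
  have r_le: "r x \<le> g x t" if "t \<ge> 0" for x t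
    unfolding r_def using that bdd by (intro cINF_lower) auto
  have r_ge: "m \<le> r x" if "\<And>t. t \<ge> 0 \<Longrightarrow> m \<le> g x t" for m x
    unfolding r_def using that by (intro cINF_greatest) auto
  show "r x \<le> q x" for x using r_le[of 0 x] by (simp add: g_def)
  show "r (- y) \<le> - q y" using r_le[of 1 "- y"] by (simp add: g_def q0)
  show "sublinear r"
  proof (rule sublinearI)
    fix x z
    have *: "r (x + z) \<le> g x s + g z t" if "s \<ge> 0" "t \<ge> 0" for s t
    proof -
      have "r (x + z) \<le> g (x + z) (s + t)" using that by (intro r_le) simp
      also have "\<dots> \<le> g x s + g z t"
        using qadd[of "x + s *\<^sub>R y" "z + t *\<^sub>R y"] by (simp add: g_def algebra_simps)
      finally show ?thesis .
    qed
    have "r (x + z) - g z t \<le> r x" if "t \<ge> 0" for t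
      by (rule r_ge) (use *[OF _ that] in \<open>simp add: algebra_simps\<close>)
    then have "r (x + z) - r x \<le> r z"
      by (intro r_ge) (simp add: algebra_simps)
    then show "r (x + z) \<le> r x + r z" by simp
  next
    show "r 0 = 0"
      using r_le[of 0 0] r_ge[of 0 0] low[of _ 0] by (simp add: g_def q0)
  next
    fix k :: real and x assume k: "0 < k"
    have "r (k *\<^sub>R x) / k \<le> r x"
    proof (rule r_ge)
      fix t :: real assume t: "0 \<le> t"
      have "r (k *\<^sub>R x) \<le> g (k *\<^sub>R x) (k * t)" using t k by (intro r_le) simp
      also have "\<dots> = k * g x t"
        using qscale[of k "x + t *\<^sub>R y"] k by (simp add: g_def algebra_simps)
      finally show "r (k *\<^sub>R x) / k \<le> g x t" using k by (simp add: field_simps)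
    qed
    then show "r (k *\<^sub>R x) \<le> k * r x" using k by (simp add: field_simps)
  qed
qed

text \<open>A minimal sublinear functional is odd, since tilting it in any direction cannot decrease it;
  and an odd sublinear functional is linear.\<close>

theorem Hahn_Banach_sublinear:
  fixes p :: "'a::real_vector \<Rightarrow> real"
  assumes p: "sublinear p"
  obtains f where "linear f" "\<And>x. f x \<le> p x"
proof -
  define A where "A = {q. sublinear q \<and> (\<forall>x. q x \<le> p x)}"
  \<comment> \<open>The order is reversed: a maximal element in Zorn's lemma is a minimal
    functional, and chains need pointwise lower bounds, which their infima provide.\<close>
  define P where "P a b \<longleftrightarrow> (\<forall>x. b x \<le> a x)" for a b :: "'a \<Rightarrow> real"
  have "\<exists>m\<in>A. \<forall>a\<in>A. P m a \<longrightarrow> a = m"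
  proof (rule predicate_Zorn)
    show "partial_order_on A (relation_of P A)"
      by (rule partial_order_on_relation_ofI) (auto simp: P_def fun_eq_iff intro: order_trans antisym)
  next
    fix C assume C: "C \<in> Chains (relation_of P A)"
    then have CA: "C \<subseteq> A" and chain: "\<And>a b. a \<in> C \<Longrightarrow> b \<in> C \<Longrightarrow> P a b \<or> P b a"
      unfolding Chains_def relation_of_def by auto
    show "\<exists>u\<in>A. \<forall>a\<in>C. P a u"
    proof (cases "C = {}")
      case True
      then show ?thesis using p unfolding A_def by auto
    next
      case False
      define u where "u x = (INF q\<in>C. q x)" for x
      have sub: "sublinear q" and le: "\<And>x. q x \<le> p x" if "q \<in> C" for q
        using that CA unfolding A_def by auto
      have "- p (- x) \<le> q x" if "q \<in> C" for q x
        using sublinear_ge[OF sub[OF that], of x] le[OF that, of "- x"] by simp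
      then have bdd: "bdd_below ((\<lambda>q. q x) ` C)" for x
        by (intro bdd_belowI[of _ "- p (- x)"]) auto
      have u_le: "u x \<le> q x" if "q \<in> C" for q x
        unfolding u_def using that bdd by (intro cINF_lower) auto
      have u_ge: "m \<le> u x" if "\<And>q. q \<in> C \<Longrightarrow> m \<le> q x" for m x
        unfolding u_def using that False by (intro cINF_greatest) auto
      have "sublinear u"
      proof (rule sublinearI)
        fix x y
        have *: "u (x + y) \<le> q x + q' y" if qq': "q \<in> C" "q' \<in> C" for q q'
        proof -
          obtain s where s: "s \<in> C" "s x \<le> q x" "s y \<le> q' y"
            using chain[OF qq'] qq' unfolding P_def by blast
          have "s (x + y) \<le> s x + s y" using sub[OF s(1)] unfolding sublinear_def by blast
          with u_le[OF s(1), of "x + y"] s show ?thesis by linarith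
        qed
        have "u (x + y) - q' y \<le> u x" if "q' \<in> C" for q'
          by (rule u_ge) (use *[OF _ that] in \<open>simp add: algebra_simps\<close>)
        then have "u (x + y) - u x \<le> u y"
          by (intro u_ge) (simp add: algebra_simps)
        then show "u (x + y) \<le> u x + u y" by simp
      next
        have "q 0 = 0" if "q \<in> C" for q
          using sub[OF that] unfolding sublinear_def by (metis mult_zero_left order_refl scale_zero_left)
        then have "u 0 = (INF q\<in>C. 0)" unfolding u_def by (intro INF_cong) auto
        then show "u 0 = 0" using False by simp
      next
        fix t :: real and x assume t: "0 < t"
        have "u (t *\<^sub>R x) / t \<le> u x"
        proof (rule u_ge)
          fix q assume q: "q \<in> C"
          have "q (t *\<^sub>R x) = t * q x" using sub[OF q] t unfolding sublinear_def by auto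
          with u_le[OF q, of "t *\<^sub>R x"] show "u (t *\<^sub>R x) / t \<le> q x"
            using t by (simp add: field_simps)
        qed
        then show "u (t *\<^sub>R x) \<le> t * u x" using t by (simp add: field_simps)
      qed
      moreover have "u x \<le> p x" for x using False u_le le by (meson ex_in_conv order_trans)
      ultimately have "u \<in> A" unfolding A_def by blast
      then show ?thesis using u_le unfolding P_def by blast
    qed
  qed
  then obtain q where "q \<in> A" and q_min: "\<forall>r\<in>A. P q r \<longrightarrow> r = q" by blast
  then have q: "sublinear q" "\<And>x. q x \<le> p x" unfolding A_def by auto
  have min: "r = q" if "sublinear r" "\<And>x. r x \<le> q x" for r
  proof -
    have "r x \<le> p x" for x using that(2) q(2) order_trans by blast
    with that have "r \<in> A" "P q r" unfolding A_def P_def by auto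
    with q_min show ?thesis by blast
  qed
  have odd: "q (- y) = - q y" for y
  proof -
    obtain r where "sublinear r" "\<And>x. r x \<le> q x" "r (- y) \<le> - q y"
      using sublinear_tilt[OF q(1)] by blast
    with min[of r] sublinear_ge[OF q(1), of y] show ?thesis by fastforce
  qed
  have add: "q (x + y) \<le> q x + q y" for x y using q(1) unfolding sublinear_def by blast
  have scale: "0 \<le> t \<Longrightarrow> q (t *\<^sub>R x) = t * q x" for t x using q(1) unfolding sublinear_def by blast
  have "linear q"
  proof (rule linearI)
    show "q (x + y) = q x + q y" for x y
      using add[of x y] add[of "- x" "- y"] odd[of x] odd[of y] odd[of "x + y"] by simp
    show "q (t *\<^sub>R x) = t *\<^sub>R q x" for t x
      using scale[of t x] scale[of "- t" x] odd[of "t *\<^sub>R x"] by (cases "0 \<le> t") auto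
  qed
  with q(2) that show thesis by blast
qed

text \<open>The norm is first tilted along \<open>u\<close>. A linear functional below the result is
  at most \<open>- norm u\<close> at \<open>- u\<close>, hence at least \<open>norm u\<close> at
  \<open>u\<close>.\<close>

corollary norming_functional:
  fixes u :: "'a::real_normed_vector"
  obtains f :: "'a \<Rightarrow> real" where "bounded_linear f" "\<And>x. \<bar>f x\<bar> \<le> norm x" "f u = norm u"
proof -
  have "sublinear (norm :: 'a \<Rightarrow> real)"
    by (rule sublinearI) (auto simp: norm_triangle_ineq)
  then obtain r :: "'a \<Rightarrow> real"
    where r: "sublinear r" "\<And>x. r x \<le> norm x" "r (- u) \<le> - norm u"
    using sublinear_tilt by blast
  from Hahn_Banach_sublinear[OF r(1)]
  obtain f where f: "linear f" "\<And>x. f x \<le> r x" by blast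
  have neg: "f (- x) = - f x" for x using f(1) by (rule linear_neg)
  have le: "f x \<le> norm x" for x using f(2)[of x] r(2)[of x] by linarith
  have bnd: "\<bar>f x\<bar> \<le> norm x" for x using le[of x] le[of "- x"] neg[of x] by simp
  have "bounded_linear f"
    using f(1) bnd by (intro bounded_linear_intro[where K = 1]) (auto simp: linear_add linear_scale)
  moreover have "f u = norm u" using f(2)[of "- u"] r(3) neg[of u] le[of u] by simp
  ultimately show thesis using that bnd by blast
qed

section \<open>Combinations of convex sets\<close>

text \<open>This bounds the diameter of the Minkowski sum of the sets
  \<open>c i *\<^sub>R V i\<close>. The form with selections makes sense without boundedness and
  survives a change of sets or weights.\<close>

definition comb_diam_le ::
    "'i set \<Rightarrow> ('i \<Rightarrow> 'a::real_normed_vector set) \<Rightarrow> ('i \<Rightarrow> real) \<Rightarrow> real \<Rightarrow> bool" where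
  "comb_diam_le A V c d \<longleftrightarrow>
     (\<forall>u\<in>Pi A V. \<forall>v\<in>Pi A V. norm (\<Sum>i\<in>A. c i *\<^sub>R (u i - v i)) \<le> d)"

lemma comb_diam_leD:
  assumes "comb_diam_le A V c d" "u \<in> Pi A V" "v \<in> Pi A V"
  shows "norm ((\<Sum>i\<in>A. c i *\<^sub>R u i) - (\<Sum>i\<in>A. c i *\<^sub>R v i)) \<le> d"
  using assms unfolding comb_diam_le_def
  by (simp add: scaleR_diff_right sum_subtractf)

lemma comb_diam_le_mono: "comb_diam_le A V c d \<Longrightarrow> d \<le> e \<Longrightarrow> comb_diam_le A V c e"
  unfolding comb_diam_le_def by (meson order_trans)

lemma comb_diam_le_subset:
  assumes "comb_diam_le A V c d" "\<And>i. i \<in> A \<Longrightarrow> V' i \<subseteq> V i"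
  shows "comb_diam_le A V' c d"
proof -
  have "Pi A V' \<subseteq> Pi A V" using assms(2) by auto
  with assms(1) show ?thesis unfolding comb_diam_le_def by blast
qed

text \<open>This heredity in the weights is what makes the decomposition of a point converge piecewise.\<close>

lemma comb_diam_le_weights:
  assumes c: "comb_diam_le A V c d"
    and V: "\<And>i. i \<in> A \<Longrightarrow> convex (V i)"
    and a: "\<And>i. i \<in> A \<Longrightarrow> 0 \<le> a i \<and> a i \<le> c i"
  shows "comb_diam_le A V a d"
  unfolding comb_diam_le_def
proof (intro ballI)
  fix u v assume u: "u \<in> Pi A V" and v: "v \<in> Pi A V"
  \<comment> \<open>Moving from \<open>v i\<close> only the fraction \<open>a i / c i\<close> of the
    way to \<open>u i\<close> turns the weight \<open>c i\<close> into \<open>a i\<close>. If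
    \<open>c i = 0\<close>, then \<open>a i = 0\<close> and the quotient is \<open>0\<close> as
    well.\<close>
  define w where "w i = v i + (a i / c i) *\<^sub>R (u i - v i)" for i
  have "w i \<in> V i" if i: "i \<in> A" for i
  proof -
    have "0 \<le> a i / c i" "a i / c i \<le> 1" using a[OF i] by (auto simp: divide_le_eq_1)
    moreover have "w i = (1 - a i / c i) *\<^sub>R v i + (a i / c i) *\<^sub>R u i"
      by (simp add: w_def algebra_simps)
    ultimately show ?thesis
      using V[OF i] u v i by (auto simp: convex_alt Pi_iff)
  qed
  then have "w \<in> Pi A V" by auto
  with c v have "norm (\<Sum>i\<in>A. c i *\<^sub>R (w i - v i)) \<le> d" unfolding comb_diam_le_def by blast
  moreover have "c i *\<^sub>R (w i - v i) = a i *\<^sub>R (u i - v i)" if "i \<in> A" for i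
    using a[OF that] by (auto simp: w_def)
  ultimately show "norm (\<Sum>i\<in>A. a i *\<^sub>R (u i - v i)) \<le> d" by simp
qed

lemma norm_comb_diff_weights:
  fixes u :: "'i \<Rightarrow> 'a::real_normed_vector"
  assumes "\<And>i. i \<in> A \<Longrightarrow> norm (u i) \<le> M" "0 \<le> M"
  shows "norm ((\<Sum>i\<in>A. c i *\<^sub>R u i) - (\<Sum>i\<in>A. g i *\<^sub>R u i)) \<le> (\<Sum>i\<in>A. \<bar>c i - g i\<bar>) * M"
proof -
  have "norm ((\<Sum>i\<in>A. c i *\<^sub>R u i) - (\<Sum>i\<in>A. g i *\<^sub>R u i)) = norm (\<Sum>i\<in>A. (c i - g i) *\<^sub>R u i)"
    by (simp add: sum_subtractf scaleR_diff_left)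
  also have "\<dots> \<le> (\<Sum>i\<in>A. \<bar>c i - g i\<bar> * M)"
    using assms by (intro sum_norm_le) (auto intro: mult_left_mono)
  finally show ?thesis by (simp add: sum_distrib_right)
qed

text \<open>Each of the two compared combinations moves by at most \<open>r\<close>, hence the
  factor 2. This carries a bound from a finite grid of weights to all weights.\<close>

lemma comb_diam_le_perturb:
  assumes g: "comb_diam_le A V g d"
    and M: "\<And>i x. i \<in> A \<Longrightarrow> x \<in> V i \<Longrightarrow> norm x \<le> M" "0 \<le> M"
    and r: "(\<Sum>i\<in>A. \<bar>c i - g i\<bar>) * M \<le> r"
  shows "comb_diam_le A V c (d + 2 * r)"
  unfolding comb_diam_le_def
proof (intro ballI)
  fix u v assume u: "u \<in> Pi A V" and v: "v \<in> Pi A V"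
  have d: "norm ((\<Sum>i\<in>A. c i *\<^sub>R w i) - (\<Sum>i\<in>A. g i *\<^sub>R w i)) \<le> r" if "w \<in> Pi A V" for w
    using that M r by (intro order_trans[OF norm_comb_diff_weights[of A w M c g]]) auto
  have "(\<Sum>i\<in>A. c i *\<^sub>R (u i - v i)) = (\<Sum>i\<in>A. c i *\<^sub>R u i) - (\<Sum>i\<in>A. c i *\<^sub>R v i)"
    by (simp add: scaleR_diff_right sum_subtractf)
  moreover have "norm (p - q) \<le> d + 2 * r"
    if "norm (p - p') \<le> r" "norm (q - q') \<le> r" "norm (p' - q') \<le> d" for p q p' q' :: 'b
    using that by norm
  ultimately show "norm (\<Sum>i\<in>A. c i *\<^sub>R (u i - v i)) \<le> d + 2 * r"
    using d[OF u] d[OF v] comb_diam_leD[OF g u v] by simp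
qed

section \<open>Trees of convex sets\<close>

text \<open>Nodes are lists, a node being a child of its tail.\<close>

locale convex_tree =
  fixes I :: "nat \<Rightarrow> nat list set" and U :: "nat \<Rightarrow> nat list \<Rightarrow> 'a::banach set" and M :: real
  assumes finite_level: "finite (I n)"
    and convex_node: "\<alpha> \<in> I n \<Longrightarrow> convex (U n \<alpha>)"
    and nonempty_node: "\<alpha> \<in> I n \<Longrightarrow> U n \<alpha> \<noteq> {}"
    and bounded_node: "\<alpha> \<in> I n \<Longrightarrow> x \<in> U n \<alpha> \<Longrightarrow> norm x \<le> M"
    and parent_level: "\<beta> \<in> I (Suc n) \<Longrightarrow> tl \<beta> \<in> I n"
    and parent_node: "\<beta> \<in> I (Suc n) \<Longrightarrow> U (Suc n) \<beta> \<subseteq> U n (tl \<beta>)"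
    and M_nonneg: "0 \<le> M"
begin

text \<open>Coherence is stated one level at a time, because weights cut down to the part below a
  node are coherent only from the level of that node on.\<close>

definition coherent :: "nat \<Rightarrow> (nat \<Rightarrow> nat list \<Rightarrow> real) \<Rightarrow> bool" where
  "coherent n a \<longleftrightarrow> (\<forall>\<alpha>\<in>I n. a n \<alpha> = (\<Sum>\<beta> | \<beta> \<in> I (Suc n) \<and> tl \<beta> = \<alpha>. a (Suc n) \<beta>))"

definition combs :: "(nat \<Rightarrow> nat list \<Rightarrow> real) \<Rightarrow> nat \<Rightarrow> 'a set" where
  "combs a n = (\<lambda>v. \<Sum>\<alpha>\<in>I n. a n \<alpha> *\<^sub>R v \<alpha>) ` Pi (I n) (U n)"

definition hull_level :: "nat \<Rightarrow> 'a set" where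
  "hull_level n = convex hull (\<Union>\<alpha>\<in>I n. U n \<alpha>)"

definition core :: "'a set" where
  "core = (\<Inter>n. closure (hull_level n))"

section \<open>Combinations along coherent weights\<close>

lemma selection_exists: obtains s where "s \<in> Pi (I n) (U n)"
proof
  show "(\<lambda>\<alpha>. SOME x. x \<in> U n \<alpha>) \<in> Pi (I n) (U n)"
    using nonempty_node by (auto simp: some_in_eq)
qed

lemma sum_over_children:
  "(\<Sum>\<beta>\<in>I (Suc n). g \<beta>) = (\<Sum>\<alpha>\<in>I n. \<Sum>\<beta> | \<beta> \<in> I (Suc n) \<and> tl \<beta> = \<alpha>. g \<beta>)"
  using parent_level by (intro sum.group[symmetric] finite_level) auto

lemma coherent_sum:
  assumes "coherent n a"
  shows "(\<Sum>\<alpha>\<in>I n. a n \<alpha>) = (\<Sum>\<beta>\<in>I (Suc n). a (Suc n) \<beta>)"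
  using assms unfolding sum_over_children coherent_def by (intro sum.cong) auto

lemma coherent_sum_levels:
  assumes "m \<le> k" "\<And>n. m \<le> n \<Longrightarrow> n < k \<Longrightarrow> coherent n a"
  shows "(\<Sum>\<alpha>\<in>I m. a m \<alpha>) = (\<Sum>\<beta>\<in>I k. a k \<beta>)"
  using assms
proof (induction k rule: dec_induct)
  case (step k)
  then show ?case using coherent_sum[of k a] by auto
qed simp

text \<open>The children of a node contribute the weight of the node times a weighted mean of their
  points, and by convexity this mean lies in the set of the node.\<close>

lemma combs_Suc_subset:
  assumes coh: "coherent n a" and nonneg: "\<And>\<beta>. \<beta> \<in> I (Suc n) \<Longrightarrow> 0 \<le> a (Suc n) \<beta>"
  shows "combs a (Suc n) \<subseteq> combs a n"
proof
  fix x assume "x \<in> combs a (Suc n)"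
  then obtain u where u: "u \<in> Pi (I (Suc n)) (U (Suc n))"
    and x: "x = (\<Sum>\<beta>\<in>I (Suc n). a (Suc n) \<beta> *\<^sub>R u \<beta>)"
    unfolding combs_def by blast
  obtain s where s: "s \<in> Pi (I n) (U n)" by (rule selection_exists)
  define ch where "ch \<alpha> = {\<beta> \<in> I (Suc n). tl \<beta> = \<alpha>}" for \<alpha>
  \<comment> \<open>For weight \<open>0\<close> there is no mean and any point of the node will do:
    the nonnegative weights of its children then vanish too.\<close>
  define v where "v \<alpha> = (if a n \<alpha> = 0 then s \<alpha>
      else (\<Sum>\<beta>\<in>ch \<alpha>. (a (Suc n) \<beta> / a n \<alpha>) *\<^sub>R u \<beta>))" for \<alpha>
  have fin: "finite (ch \<alpha>)" for \<alpha> using finite_level[of "Suc n"] unfolding ch_def by simp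
  have an: "a n \<alpha> = (\<Sum>\<beta>\<in>ch \<alpha>. a (Suc n) \<beta>)" if "\<alpha> \<in> I n" for \<alpha>
    using coh that unfolding coherent_def ch_def by blast
  have an_nonneg: "0 \<le> a n \<alpha>" if "\<alpha> \<in> I n" for \<alpha>
    unfolding an[OF that] using nonneg by (intro sum_nonneg) (auto simp: ch_def)
  have "v \<alpha> \<in> U n \<alpha>" if \<alpha>: "\<alpha> \<in> I n" for \<alpha>
  proof (cases "a n \<alpha> = 0")
    case True
    then show ?thesis using s \<alpha> unfolding v_def by auto
  next
    case False
    have "(\<Sum>\<beta>\<in>ch \<alpha>. (a (Suc n) \<beta> / a n \<alpha>) *\<^sub>R u \<beta>) \<in> U n \<alpha>"
    proof (rule convex_sum[OF fin convex_node[OF \<alpha>]])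
      show "(\<Sum>\<beta>\<in>ch \<alpha>. a (Suc n) \<beta> / a n \<alpha>) = 1"
        using False an[OF \<alpha>] by (simp flip: sum_divide_distrib)
      show "0 \<le> a (Suc n) \<beta> / a n \<alpha>" if "\<beta> \<in> ch \<alpha>" for \<beta>
        using that an_nonneg[OF \<alpha>] nonneg by (auto simp: ch_def)
      show "u \<beta> \<in> U n \<alpha>" if "\<beta> \<in> ch \<alpha>" for \<beta>
        using that u parent_node by (auto simp: ch_def)
    qed
    then show ?thesis using False unfolding v_def by simp
  qed
  then have "v \<in> Pi (I n) (U n)" by auto
  moreover have "a n \<alpha> *\<^sub>R v \<alpha> = (\<Sum>\<beta>\<in>ch \<alpha>. a (Suc n) \<beta> *\<^sub>R u \<beta>)" if \<alpha>: "\<alpha> \<in> I n" for \<alpha>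
  proof (cases "a n \<alpha> = 0")
    case True
    then have "(\<Sum>\<beta>\<in>ch \<alpha>. a (Suc n) \<beta>) = 0" using an[OF \<alpha>] by simp
    then have "a (Suc n) \<beta> = 0" if "\<beta> \<in> ch \<alpha>" for \<beta>
      using that fin[of \<alpha>] nonneg by (subst (asm) sum_nonneg_eq_0_iff) (auto simp: ch_def)
    then show ?thesis using True by simp
  next
    case False
    then show ?thesis by (simp add: v_def scaleR_sum_right)
  qed
  then have "x = (\<Sum>\<alpha>\<in>I n. a n \<alpha> *\<^sub>R v \<alpha>)"
    unfolding x sum_over_children by (simp add: ch_def)
  ultimately show "x \<in> combs a n" unfolding combs_def by blast
qed

lemma combs_antimono:
  assumes "m \<le> k" "\<And>n. m \<le> n \<Longrightarrow> n < k \<Longrightarrow> coherent n a"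
    "\<And>n \<beta>. m \<le> n \<Longrightarrow> n \<le> k \<Longrightarrow> \<beta> \<in> I n \<Longrightarrow> 0 \<le> a n \<beta>"
  shows "combs a k \<subseteq> combs a m"
  using assms
proof (induction k rule: dec_induct)
  case (step k)
  have "combs a (Suc k) \<subseteq> combs a k"
    using step by (intro combs_Suc_subset) auto
  also have "\<dots> \<subseteq> combs a m" using step by auto
  finally show ?case .
qed simp

lemma combs_subset_hull_level:
  assumes "\<And>\<alpha>. \<alpha> \<in> I n \<Longrightarrow> 0 \<le> a n \<alpha>" "(\<Sum>\<alpha>\<in>I n. a n \<alpha>) = 1"
  shows "combs a n \<subseteq> hull_level n"
proof
  fix x assume "x \<in> combs a n"
  then obtain v where v: "v \<in> Pi (I n) (U n)" "x = (\<Sum>\<alpha>\<in>I n. a n \<alpha> *\<^sub>R v \<alpha>)"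
    unfolding combs_def by blast
  show "x \<in> hull_level n"
    unfolding v(2) hull_level_def using assms v(1)
    by (intro convex_sum finite_level convex_convex_hull) (auto intro!: hull_inc)
qed

lemma hull_level_antimono: "m \<le> k \<Longrightarrow> hull_level k \<subseteq> hull_level m"
proof (induction k rule: dec_induct)
  case (step k)
  have "hull_level (Suc k) \<subseteq> hull_level k"
    unfolding hull_level_def using parent_node parent_level by (intro hull_mono) blast
  with step show ?case by blast
qed simp

lemma closed_core: "closed core" and convex_core: "convex core"
  unfolding core_def hull_level_def by (auto intro!: convex_INT convex_closure convex_convex_hull)

text \<open>The closures decrease, so one level with small diameter for each \<open>e\<close>
  suffices for Cantor's intersection theorem; completeness enters here. The total weight is
  arbitrary, as is needed for parts of a point.\<close>

lemma coherent_combs_limit: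
  assumes coh: "\<And>n. n0 \<le> n \<Longrightarrow> coherent n a"
    and nonneg: "\<And>n \<beta>. n0 \<le> n \<Longrightarrow> \<beta> \<in> I n \<Longrightarrow> 0 \<le> a n \<beta>"
    and small: "\<And>e. 0 < e \<Longrightarrow> \<exists>m\<ge>n0. comb_diam_le (I m) (U m) (a m) e"
  shows "\<exists>t. (\<Inter>m\<in>{n0..}. closure (combs a m)) = {t}"
proof -
  have "\<exists>t. \<Inter> (range (\<lambda>n. closure (combs a (n0 + n)))) = {t}"
  proof (rule decreasing_closed_nest_sing)
    fix n
    obtain s where "s \<in> Pi (I (n0 + n)) (U (n0 + n))" by (rule selection_exists)
    then show "closure (combs a (n0 + n)) \<noteq> {}" unfolding combs_def by auto
  next
    fix m n :: nat assume "m \<le> n"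
    then show "closure (combs a (n0 + n)) \<subseteq> closure (combs a (n0 + m))"
      using coh nonneg by (intro closure_mono combs_antimono) auto
  next
    fix e :: real assume e: "0 < e"
    then obtain m where m: "m \<ge> n0" and d: "comb_diam_le (I m) (U m) (a m) (e / 2)"
      using small[of "e / 2"] by auto
    \<comment> \<open>The bound passes to the closure in one argument at a time, since closed balls
      are closed; \<open>e / 2\<close> leaves room for the strict inequality.\<close>
    have pair: "combs a m \<subseteq> cball y (e / 2)" if "y \<in> combs a m" for y
      using that comb_diam_leD[OF d] unfolding combs_def by (auto simp: dist_norm)
    have clos: "closure (combs a m) \<subseteq> cball y (e / 2)" if "y \<in> combs a m" for y
      using pair[OF that] by (rule closure_minimal) simp
    have "combs a m \<subseteq> cball x (e / 2)" if x: "x \<in> closure (combs a m)" for x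
    proof
      fix y assume "y \<in> combs a m"
      with clos x have "x \<in> cball y (e / 2)" by blast
      then show "y \<in> cball x (e / 2)" by (simp add: dist_commute)
    qed
    then have clos': "closure (combs a m) \<subseteq> cball x (e / 2)" if "x \<in> closure (combs a m)" for x
      using that by (intro closure_minimal) simp_all
    have "\<forall>x\<in>closure (combs a m). \<forall>y\<in>closure (combs a m). dist x y < e"
    proof (intro ballI)
      fix x y assume "x \<in> closure (combs a m)" "y \<in> closure (combs a m)"
      then have "y \<in> cball x (e / 2)" using clos' by blast
      then show "dist x y < e" using e by simp
    qed
    then show "\<exists>n. \<forall>x\<in>closure (combs a (n0 + n)). \<forall>y\<in>closure (combs a (n0 + n)). dist x y < e"
      using m by (intro exI[of _ "m - n0"]) simp
  qed simp
  moreover have "(\<Inter>m\<in>{n0..}. closure (combs a m)) = \<Inter> (range (\<lambda>n. closure (combs a (n0 + n))))"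
    by (auto simp: le_iff_add)
  ultimately show ?thesis by simp
qed

text \<open>Division by the total weight \<open>s\<close> gives probability weights, whose
  combinations lie in the hulls from level \<open>n0\<close> on. The earlier hulls are
  larger.\<close>

lemma scaled_limit_in_core:
  assumes coh: "\<And>n. n0 \<le> n \<Longrightarrow> coherent n a"
    and nonneg: "\<And>n \<beta>. n0 \<le> n \<Longrightarrow> \<beta> \<in> I n \<Longrightarrow> 0 \<le> a n \<beta>"
    and s: "(\<Sum>\<beta>\<in>I n0. a n0 \<beta>) = s" "0 < s"
    and t: "\<And>m. n0 \<le> m \<Longrightarrow> t \<in> closure (combs a m)"
  shows "(1 / s) *\<^sub>R t \<in> core"
proof -
  have ge: "(1 / s) *\<^sub>R t \<in> closure (hull_level m)" if m: "n0 \<le> m" for m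
  proof -
    define b where "b n \<beta> = a n \<beta> / s" for n \<beta>
    have "(*\<^sub>R) (1 / s) ` combs a m \<subseteq> combs b m"
      unfolding combs_def image_image b_def by (auto simp: scaleR_sum_right image_iff)
    also have "\<dots> \<subseteq> hull_level m"
      using coherent_sum_levels[OF m, of a] coh nonneg[OF m] s
      by (intro combs_subset_hull_level) (auto simp: b_def simp flip: sum_divide_distrib)
    finally have "closure ((*\<^sub>R) (1 / s) ` combs a m) \<subseteq> closure (hull_level m)"
      by (rule closure_mono)
    moreover have "(1 / s) *\<^sub>R t \<in> closure ((*\<^sub>R) (1 / s) ` combs a m)"
      using imageI[OF t[OF m], of "(*\<^sub>R) (1 / s)"] by (simp only: closure_scaleR)
    ultimately show ?thesis by blast
  qed
  have "(1 / s) *\<^sub>R t \<in> closure (hull_level n)" for n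
    using ge[of "max n0 n"] closure_mono[OF hull_level_antimono[of n "max n0 n"]] by auto
  then show ?thesis unfolding core_def by blast
qed

section \<open>Representing the points of the core by coherent weights\<close>

lemma coherent_extend_down:
  assumes "\<And>\<beta>. \<beta> \<in> I k \<Longrightarrow> 0 \<le> c \<beta>"
  shows "\<exists>a. a k = c \<and> (\<forall>n<k. coherent n a) \<and> (\<forall>n\<le>k. \<forall>\<alpha>\<in>I n. 0 \<le> a n \<alpha>)"
  using assms
proof (induction k arbitrary: c)
  case 0
  then show ?case by (intro exI[of _ "\<lambda>_. c"]) auto
next
  case (Suc k)
  define c' where "c' \<alpha> = (\<Sum>\<beta> | \<beta> \<in> I (Suc k) \<and> tl \<beta> = \<alpha>. c \<beta>)" for \<alpha>
  have "0 \<le> c' \<alpha>" for \<alpha> unfolding c'_def using Suc.prems by (intro sum_nonneg) auto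
  then obtain a where a: "a k = c'" "\<forall>n<k. coherent n a" "\<forall>n\<le>k. \<forall>\<alpha>\<in>I n. 0 \<le> a n \<alpha>"
    using Suc.IH[of c'] by blast
  define b where "b = a(Suc k := c)"
  have "coherent n b" if "n < Suc k" for n
    using that a unfolding b_def coherent_def by (cases "n = k") (auto simp: c'_def)
  moreover have "0 \<le> b n \<alpha>" if "n \<le> Suc k" "\<alpha> \<in> I n" for n \<alpha>
    using that a(3) Suc.prems unfolding b_def by (cases "n = Suc k") auto
  moreover have "b (Suc k) = c" by (simp add: b_def)
  ultimately show ?case by blast
qed

text \<open>An approximation of \<open>x\<close> on level \<open>k\<close> gives coherent weights up
  to level \<open>k\<close>, and a subsequence of these converges at every node. Levels are finite
  and nodes bounded by \<open>M\<close>, so convergence of the weights on a level makes the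
  combinations close in norm.\<close>

lemma core_coherent_weights:
  assumes x: "x \<in> core"
  obtains c where "\<And>n. coherent n c" "\<And>n \<alpha>. \<alpha> \<in> I n \<Longrightarrow> 0 \<le> c n \<alpha>"
    "\<And>n. (\<Sum>\<alpha>\<in>I n. c n \<alpha>) = 1" "\<And>n. x \<in> closure (combs c n)"
proof -
  have "\<exists>a. (\<forall>n<k. coherent n a) \<and> (\<forall>n\<le>k. \<forall>\<alpha>\<in>I n. 0 \<le> a n \<alpha>) \<and>
      (\<Sum>\<alpha>\<in>I k. a k \<alpha>) = 1 \<and> (\<exists>y\<in>combs a k. dist y x < inverse (Suc k))" for k
  proof -
    have "x \<in> closure (hull_level k)" using x unfolding core_def by blast
    moreover have "0 < inverse (real (Suc k))" by simp
    ultimately obtain y where y: "y \<in> hull_level k" "dist y x < inverse (Suc k)"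
      using closure_approachable by blast
    have "hull_level k = {\<Sum>i\<in>I k. c i *\<^sub>R s i | c s.
        (\<forall>i\<in>I k. 0 \<le> c i) \<and> sum c (I k) = 1 \<and> (\<forall>i\<in>I k. s i \<in> U k i)}"
      unfolding hull_level_def
      using finite_level convex_node nonempty_node by (intro convex_hull_finite_union) auto
    with y obtain c s where c: "\<forall>i\<in>I k. 0 \<le> c i" "sum c (I k) = 1" "\<forall>i\<in>I k. s i \<in> U k i"
      "y = (\<Sum>i\<in>I k. c i *\<^sub>R s i)" by blast
    obtain a where a: "a k = c" "\<forall>n<k. coherent n a" "\<forall>n\<le>k. \<forall>\<alpha>\<in>I n. 0 \<le> a n \<alpha>"
      using coherent_extend_down[of k c] c by blast
    moreover have "y \<in> combs a k" unfolding combs_def using c a(1) by auto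
    ultimately show ?thesis using c(2) y(2) by (intro exI[of _ a]) auto
  qed
  then obtain a where coh: "\<And>k n. n < k \<Longrightarrow> coherent n (a k)"
    and nonneg: "\<And>k n \<alpha>. n \<le> k \<Longrightarrow> \<alpha> \<in> I n \<Longrightarrow> 0 \<le> a k n \<alpha>"
    and one: "\<And>k. (\<Sum>\<alpha>\<in>I k. a k k \<alpha>) = 1"
    and near: "\<And>k. \<exists>y\<in>combs (a k) k. dist y x < inverse (Suc k)"
    by metis
  have sum1: "(\<Sum>\<alpha>\<in>I n. a k n \<alpha>) = 1" if "n \<le> k" for k n
    using coherent_sum_levels[OF that, of "a k"] coh one by simp
  have le1: "a k n \<alpha> \<le> 1" if "n \<le> k" "\<alpha> \<in> I n" for k n \<alpha>
    using member_le_sum[of \<alpha> "I n" "a k n"] finite_level nonneg that sum1[OF that(1)] by auto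
  \<comment> \<open>Extension by \<open>0\<close> gives points of a cube over a countable index set,
    where compactness yields convergent subsequences. At a fixed node the extension eventually
    agrees with the weights.\<close>
  define F where "F k p = (if fst p \<le> k \<and> snd p \<in> I (fst p) then a k (fst p) (snd p) else 0)"
    for k and p :: "nat \<times> nat list"
  have "compactin (product_topology (\<lambda>_. euclidean) UNIV) (PiE UNIV (\<lambda>_::nat \<times> nat list. {0..1::real}))"
    unfolding compactin_PiE by simp
  then have "compact (PiE UNIV (\<lambda>_::nat \<times> nat list. {0..1::real}))"
    by (simp add: euclidean_product_topology)
  moreover have "F k \<in> PiE UNIV (\<lambda>_. {0..1})" for k
    using nonneg le1 by (auto simp: F_def)
  ultimately obtain g r where g: "g \<in> PiE UNIV (\<lambda>_::nat \<times> nat list. {0..1::real})"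
    and r: "strict_mono r" and lim: "(F \<circ> r) \<longlonglongrightarrow> g"
    unfolding compact_def by metis
  have ptw: "(\<lambda>k. F (r k) p) \<longlonglongrightarrow> g p" for p
    using continuous_on_tendsto_compose[OF continuous_on_product_coordinates[of p] lim]
    by (simp add: comp_def)
  have ev: "\<forall>\<^sub>F k in sequentially. n \<le> r k" for n
    using filterlim_subseq[OF r] unfolding filterlim_at_top by blast
  define c where "c n \<alpha> = g (n, \<alpha>)" for n \<alpha>
  have lima: "(\<lambda>k. a (r k) n \<alpha>) \<longlonglongrightarrow> c n \<alpha>" if "\<alpha> \<in> I n" for n \<alpha>
  proof (rule Lim_transform_eventually)
    show "(\<lambda>k. F (r k) (n, \<alpha>)) \<longlonglongrightarrow> c n \<alpha>" using ptw unfolding c_def .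
    show "\<forall>\<^sub>F k in sequentially. F (r k) (n, \<alpha>) = a (r k) n \<alpha>"
      using ev[of n] by eventually_elim (use that in \<open>simp add: F_def\<close>)
  qed
  have c_nonneg: "0 \<le> c n \<alpha>" for n \<alpha> using g by (auto simp: c_def PiE_iff)
  have c_coh: "coherent n c" for n
    unfolding coherent_def
  proof
    fix \<alpha> assume \<alpha>: "\<alpha> \<in> I n"
    have "(\<lambda>k. \<Sum>\<beta> | \<beta> \<in> I (Suc n) \<and> tl \<beta> = \<alpha>. a (r k) (Suc n) \<beta>)
        \<longlonglongrightarrow> (\<Sum>\<beta> | \<beta> \<in> I (Suc n) \<and> tl \<beta> = \<alpha>. c (Suc n) \<beta>)"
      by (intro tendsto_sum lima) auto
    moreover have "(\<lambda>k. \<Sum>\<beta> | \<beta> \<in> I (Suc n) \<and> tl \<beta> = \<alpha>. a (r k) (Suc n) \<beta>) \<longlonglongrightarrow> c n \<alpha>"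
    proof (rule Lim_transform_eventually[OF lima[OF \<alpha>]])
      show "\<forall>\<^sub>F k in sequentially. a (r k) n \<alpha> =
          (\<Sum>\<beta> | \<beta> \<in> I (Suc n) \<and> tl \<beta> = \<alpha>. a (r k) (Suc n) \<beta>)"
        using ev[of "Suc n"]
        by eventually_elim (use coh \<alpha> in \<open>auto simp: coherent_def\<close>)
    qed
    ultimately show "c n \<alpha> = (\<Sum>\<beta> | \<beta> \<in> I (Suc n) \<and> tl \<beta> = \<alpha>. c (Suc n) \<beta>)"
      using LIMSEQ_unique by blast
  qed
  have c_one: "(\<Sum>\<alpha>\<in>I n. c n \<alpha>) = 1" for n
  proof -
    have "(\<lambda>k. \<Sum>\<alpha>\<in>I n. a (r k) n \<alpha>) \<longlonglongrightarrow> (\<Sum>\<alpha>\<in>I n. c n \<alpha>)"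
      by (intro tendsto_sum lima)
    moreover have "(\<lambda>k. \<Sum>\<alpha>\<in>I n. a (r k) n \<alpha>) \<longlonglongrightarrow> 1"
      by (rule tendsto_eventually) (use ev[of n] in \<open>eventually_elim, simp add: sum1\<close>)
    ultimately show ?thesis using LIMSEQ_unique by blast
  qed
  have c_near: "x \<in> closure (combs c n)" for n
    unfolding closure_approachable
  proof (intro allI impI)
    fix e :: real assume e: "0 < e"
    have "(\<lambda>k. (\<Sum>\<alpha>\<in>I n. \<bar>c n \<alpha> - a (r k) n \<alpha>\<bar>) * M) \<longlonglongrightarrow> (\<Sum>\<alpha>\<in>I n. \<bar>c n \<alpha> - c n \<alpha>\<bar>) * M"
      by (intro tendsto_intros lima)
    then have "\<forall>\<^sub>F k in sequentially. (\<Sum>\<alpha>\<in>I n. \<bar>c n \<alpha> - a (r k) n \<alpha>\<bar>) * M < e / 2"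
      using e by (intro order_tendstoD(2)[where a = "e / 2"]) auto
    moreover have "\<forall>\<^sub>F k in sequentially. inverse (Suc (r k)) < e / 2"
    proof -
      have "(\<lambda>k. inverse (real (Suc (r k)))) \<longlonglongrightarrow> 0"
        using LIMSEQ_subseq_LIMSEQ[OF LIMSEQ_inverse_real_of_nat r] by (simp add: comp_def)
      then show ?thesis using e by (intro order_tendstoD(2)) auto
    qed
    ultimately have "\<forall>\<^sub>F k in sequentially. n \<le> r k \<and> inverse (Suc (r k)) < e / 2 \<and>
        (\<Sum>\<alpha>\<in>I n. \<bar>c n \<alpha> - a (r k) n \<alpha>\<bar>) * M < e / 2"
      using ev[of n] by eventually_elim simp
    from eventually_happens'[OF sequentially_bot this]
    obtain k where k: "n \<le> r k" "inverse (Suc (r k)) < e / 2"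
      "(\<Sum>\<alpha>\<in>I n. \<bar>c n \<alpha> - a (r k) n \<alpha>\<bar>) * M < e / 2"
      by blast
    obtain y where y: "y \<in> combs (a (r k)) (r k)" "dist y x < inverse (Suc (r k))"
      using near by blast
    \<comment> \<open>The approximation made on level \<open>r k\<close> is also a combination on
      the fixed level \<open>n\<close>, where its weights are already close to
      \<open>c n\<close>.\<close>
    have "combs (a (r k)) (r k) \<subseteq> combs (a (r k)) n"
      using coh nonneg by (intro combs_antimono k) auto
    with y(1) obtain v where v: "v \<in> Pi (I n) (U n)" "y = (\<Sum>\<alpha>\<in>I n. a (r k) n \<alpha> *\<^sub>R v \<alpha>)"
      unfolding combs_def by blast
    have "norm ((\<Sum>\<alpha>\<in>I n. c n \<alpha> *\<^sub>R v \<alpha>) - y) \<le> (\<Sum>\<alpha>\<in>I n. \<bar>c n \<alpha> - a (r k) n \<alpha>\<bar>) * M"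
      unfolding v(2) using v(1) bounded_node M_nonneg by (intro norm_comb_diff_weights) auto
    then have "dist (\<Sum>\<alpha>\<in>I n. c n \<alpha> *\<^sub>R v \<alpha>) y < e / 2" using k(3) by (simp add: dist_norm)
    moreover have "dist x y < e / 2" using k(2) y(2) by (simp add: dist_commute)
    ultimately have "dist (\<Sum>\<alpha>\<in>I n. c n \<alpha> *\<^sub>R v \<alpha>) x < e" by (rule dist_triangle_half_l)
    then show "\<exists>y\<in>combs c n. dist y x < e" using v(1) unfolding combs_def by blast
  qed
  show thesis using that c_coh c_nonneg c_one c_near by blast
qed

text \<open>The weights split into those below \<open>\<alpha>\<close> and the rest. Both parts are
  dominated by \<open>c\<close>, so their combinations shrink to points \<open>y\<close> and
  \<open>z\<close> with \<open>x = y + z\<close>. After normalization \<open>x\<close> is a convex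
  combination of two points of \<open>core\<close>; extremality makes \<open>x\<close> the
  normalized \<open>y\<close>, which lies in the closure of the node.\<close>

lemma extreme_point_in_closure_node:
  assumes ext: "x extreme_point_of core"
    and coh: "\<And>n. coherent n c" and nonneg: "\<And>n \<alpha>. \<alpha> \<in> I n \<Longrightarrow> 0 \<le> c n \<alpha>"
    and one: "\<And>n. (\<Sum>\<alpha>\<in>I n. c n \<alpha>) = 1" and near: "\<And>n. x \<in> closure (combs c n)"
    and small: "\<And>e N. 0 < e \<Longrightarrow> \<exists>m\<ge>N. comb_diam_le (I m) (U m) (c m) e"
    and \<alpha>: "\<alpha> \<in> I n" "0 < c n \<alpha>"
  shows "x \<in> closure (U n \<alpha>)"
proof -
  define s where "s = c n \<alpha>"
  \<comment> \<open>For \<open>m \<ge> n\<close>, removing \<open>m - n\<close> heads leads to the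
    ancestor on level \<open>n\<close>.\<close>
  define below where "below m \<beta> \<longleftrightarrow> (tl ^^ (m - n)) \<beta> = \<alpha>" for m \<beta>
  define a where "a m \<beta> = (if below m \<beta> then c m \<beta> else 0)" for m \<beta>
  define b where "b m \<beta> = (if below m \<beta> then 0 else c m \<beta>)" for m \<beta>
  have below_Suc: "below (Suc m) \<beta> \<longleftrightarrow> below m (tl \<beta>)" if "n \<le> m" for m \<beta>
    using that by (simp add: below_def Suc_diff_le funpow_swap1)
  have a_coh: "coherent m a" and b_coh: "coherent m b" if "n \<le> m" for m
    using coh[of m] unfolding coherent_def a_def b_def by (auto simp: below_Suc[OF that])
  have ab: "0 \<le> a m \<beta> \<and> a m \<beta> \<le> c m \<beta>" "0 \<le> b m \<beta> \<and> b m \<beta> \<le> c m \<beta>"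
    if "\<beta> \<in> I m" for m \<beta>
    using nonneg[OF that] by (auto simp: a_def b_def)
  have a_small: "\<exists>m\<ge>n. comb_diam_le (I m) (U m) (a m) e"
    and b_small: "\<exists>m\<ge>n. comb_diam_le (I m) (U m) (b m) e" if "0 < e" for e
    using small[OF that, of n] comb_diam_le_weights ab convex_node by metis+
  have "\<exists>y. (\<Inter>m\<in>{n..}. closure (combs a m)) = {y}"
    using a_coh ab(1) a_small by (intro coherent_combs_limit) auto
  then obtain y where y: "\<And>m. n \<le> m \<Longrightarrow> y \<in> closure (combs a m)" by force
  have "\<exists>z. (\<Inter>m\<in>{n..}. closure (combs b m)) = {z}"
    using b_coh ab(2) b_small by (intro coherent_combs_limit) auto
  then obtain z where z: "\<And>m. n \<le> m \<Longrightarrow> z \<in> closure (combs b m)" by force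
  have yz: "y + z \<in> closure (combs c m)" if m: "n \<le> m" for m
  proof -
    have "u + v \<in> combs c m" if "u \<in> combs a m" "v \<in> combs b m" for u v
    proof -
      obtain u' v' where u': "u' \<in> Pi (I m) (U m)" "u = (\<Sum>\<beta>\<in>I m. a m \<beta> *\<^sub>R u' \<beta>)"
        and v': "v' \<in> Pi (I m) (U m)" "v = (\<Sum>\<beta>\<in>I m. b m \<beta> *\<^sub>R v' \<beta>)"
        using \<open>u \<in> combs a m\<close> \<open>v \<in> combs b m\<close> unfolding combs_def by blast
      define w where "w \<beta> = (if below m \<beta> then u' \<beta> else v' \<beta>)" for \<beta>
      have "u + v = (\<Sum>\<beta>\<in>I m. c m \<beta> *\<^sub>R w \<beta>)"
        unfolding u'(2) v'(2) sum.distrib[symmetric]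
        by (intro sum.cong) (auto simp: a_def b_def w_def)
      moreover have "w \<in> Pi (I m) (U m)" using u'(1) v'(1) by (auto simp: w_def)
      ultimately show ?thesis unfolding combs_def by blast
    qed
    then have "{u + v |u v. u \<in> combs a m \<and> v \<in> combs b m} \<subseteq> combs c m" by blast
    moreover have "y + z \<in> closure {u + v |u v. u \<in> combs a m \<and> v \<in> combs b m}"
      unfolding closure_approachable
    proof (intro allI impI)
      fix e :: real assume "0 < e"
      then obtain u v where "u \<in> combs a m" "dist u y < e / 2" "v \<in> combs b m" "dist v z < e / 2"
        using y[OF m] z[OF m] closure_approachable by (metis half_gt_zero)
      moreover have "dist (u + v) (y + z) \<le> dist u y + dist v z" by (rule dist_triangle_add)
      ultimately show "\<exists>w\<in>{u + v |u v. u \<in> combs a m \<and> v \<in> combs b m}. dist w (y + z) < e"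
        by (intro bexI[of _ "u + v"]) auto
    qed
    ultimately show ?thesis using closure_mono by blast
  qed
  \<comment> \<open>Both \<open>x\<close> and \<open>y + z\<close> belong to this intersection, so
    its being a single point identifies them.\<close>
  have "\<exists>t. (\<Inter>m\<in>{n..}. closure (combs c m)) = {t}"
    using coh nonneg small by (intro coherent_combs_limit) auto
  moreover have "y + z \<in> (\<Inter>m\<in>{n..}. closure (combs c m))" using yz by simp
  moreover have "x \<in> (\<Inter>m\<in>{n..}. closure (combs c m))" using near by simp
  ultimately have xyz: "x = y + z" by (metis singletonD)
  have delta: "a n \<beta> = (if \<beta> = \<alpha> then s else 0)" for \<beta>
    by (simp add: a_def below_def s_def)
  have a_sum: "(\<Sum>\<beta>\<in>I n. a n \<beta>) = s"
    using \<alpha> finite_level by (simp add: delta)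
  have "(\<Sum>\<beta>\<in>I n. a n \<beta>) + (\<Sum>\<beta>\<in>I n. b n \<beta>) = (\<Sum>\<beta>\<in>I n. c n \<beta>)"
    unfolding sum.distrib[symmetric] by (intro sum.cong) (auto simp: a_def b_def)
  then have b_sum: "(\<Sum>\<beta>\<in>I n. b n \<beta>) = 1 - s" using a_sum one by simp
  have s: "0 < s" "s \<le> 1"
    using \<alpha> b_sum sum_nonneg[of "I n" "b n"] ab(2) by (auto simp: s_def)
  have y_core: "(1 / s) *\<^sub>R y \<in> core"
    using a_coh ab(1) a_sum s(1) y by (intro scaled_limit_in_core[of n a s]) auto
  have "x = (1 / s) *\<^sub>R y"
  proof (cases "s = 1")
    \<comment> \<open>All the weight lies below \<open>\<alpha>\<close>, so \<open>z\<close> cannot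
      be normalized; but then \<open>z = 0\<close>.\<close>
    case True
    then have "b n \<beta> = 0" if "\<beta> \<in> I n" for \<beta>
      using b_sum that finite_level ab(2) by (simp add: sum_nonneg_eq_0_iff)
    then have "combs b n \<subseteq> {0}" unfolding combs_def by auto
    then have "z = 0" using z[of n] closure_mono[of "combs b n" "{0}"] by auto
    then show ?thesis using xyz True by simp
  next
    case False
    then have s1: "s < 1" using s by simp
    have z_core: "(1 / (1 - s)) *\<^sub>R z \<in> core"
      using b_coh ab(2) b_sum s1 z by (intro scaled_limit_in_core[of n b "1 - s"]) auto
    have x: "x = (1 - s) *\<^sub>R ((1 / (1 - s)) *\<^sub>R z) + s *\<^sub>R ((1 / s) *\<^sub>R y)"
      using s1 s xyz by simp
    have "x \<notin> open_segment ((1 / (1 - s)) *\<^sub>R z) ((1 / s) *\<^sub>R y)"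
      using ext z_core y_core unfolding extreme_point_of_def by blast
    then have eq: "(1 / (1 - s)) *\<^sub>R z = (1 / s) *\<^sub>R y"
      using x s(1) s1 unfolding in_segment by blast
    show ?thesis using x unfolding eq by (simp flip: scaleR_add_left del: scaleR_scaleR)
  qed
  \<comment> \<open>On level \<open>n\<close> itself the weights \<open>a n\<close> are concentrated
    at \<open>\<alpha>\<close>.\<close>
  moreover have "combs a n \<subseteq> (*\<^sub>R) s ` U n \<alpha>"
    unfolding combs_def using \<alpha> finite_level by (auto simp: delta if_distrib[of "\<lambda>t. t *\<^sub>R _"] cong: if_cong)
  then have "y \<in> (*\<^sub>R) s ` closure (U n \<alpha>)"
    unfolding closure_scaleR using y[of n] closure_mono by blast
  ultimately show ?thesis using s by auto
qed

end

section \<open>Avoiding balls\<close>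

text \<open>\<open>op\<close> stands for the nonempty convex relatively open subsets of a set all of whose nonempty
  relatively open subsets have diameter greater than \<open>\<epsilon>\<close>.\<close>

locale wide_open_sets =
  fixes op :: "'a::banach set \<Rightarrow> bool" and M \<epsilon> :: real and b :: "nat \<Rightarrow> 'a"
  assumes op_convex: "op V \<Longrightarrow> convex V"
    and op_nonempty: "op V \<Longrightarrow> V \<noteq> {}"
    and op_bounded: "op V \<Longrightarrow> x \<in> V \<Longrightarrow> norm x \<le> M"
    and op_halfspace: "op V \<Longrightarrow> bounded_linear f \<Longrightarrow> V \<inter> {y. (f y :: real) > r} \<noteq> {} \<Longrightarrow>
      op (V \<inter> {y. f y > r})"
    and op_comb: "op V \<Longrightarrow> 0 < \<eta> \<Longrightarrow> \<exists>(n::nat) l W. (\<forall>i<n. 0 \<le> l i) \<and> (\<Sum>i<n. l i) = 1 \<and>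
      (\<forall>i<n. op (W i) \<and> W i \<subseteq> V) \<and> comb_diam_le {..<n} W l \<eta>"
    and op_wide: "op V \<Longrightarrow> \<exists>u\<in>V. \<exists>v\<in>V. \<epsilon> < norm (u - v)"
    and \<epsilon>_pos: "0 < \<epsilon>" and M_pos: "0 < M"
    and dense: "0 < e \<Longrightarrow> \<exists>k. dist x (b k) < e"
begin

text \<open>Here \<open>p\<close> and \<open>r\<close> are centre and radius of the ball to be
  avoided, and \<open>d\<close> is the diameter that excuses from avoiding it.\<close>

definition far_or_small :: "'i set \<Rightarrow> ('i \<Rightarrow> 'a set) \<Rightarrow> 'a \<Rightarrow> real \<Rightarrow> real \<Rightarrow> ('i \<Rightarrow> real) \<Rightarrow> bool" where
  "far_or_small A V p d r g \<longleftrightarrow>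
     comb_diam_le A V g d \<or> (\<forall>u\<in>Pi A V. r \<le> norm ((\<Sum>i\<in>A. g i *\<^sub>R u i) - p))"

section \<open>Shrinking the sets of a level\<close>

lemma far_or_small_subset:
  assumes "far_or_small A V p d r g" "\<And>i. i \<in> A \<Longrightarrow> V' i \<subseteq> V i"
  shows "far_or_small A V' p d r g"
proof -
  have "Pi A V' \<subseteq> Pi A V" using assms(2) by auto
  with assms show ?thesis unfolding far_or_small_def using comb_diam_le_subset by blast
qed

text \<open>If the diameter exceeds \<open>d\<close>, some combination \<open>S w\<close> has
  distance at least \<open>d / 2\<close> from \<open>p\<close>. Half-spaces of a functional norming
  \<open>S w - p\<close>, one for each \<open>w i\<close>, keep all combinations of the smaller sets
  away from \<open>p\<close>.\<close>

lemma shrink_single_weight: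
  assumes op: "\<And>i. i \<in> A \<Longrightarrow> op (V i)" and d: "0 < d"
    and g: "\<And>i. i \<in> A \<Longrightarrow> 0 \<le> g i"
  obtains V' where "\<And>i. i \<in> A \<Longrightarrow> op (V' i) \<and> V' i \<subseteq> V i" "far_or_small A V' p d (3 * d / 8) g"
proof (cases "comb_diam_le A V g d")
  case True
  then show ?thesis using op that[of V] unfolding far_or_small_def by auto
next
  case False
  define S where "S u = (\<Sum>i\<in>A. g i *\<^sub>R u i :: 'a)" for u
  from False obtain u v where u: "u \<in> Pi A V" and v: "v \<in> Pi A V"
    and "\<not> norm (\<Sum>i\<in>A. g i *\<^sub>R (u i - v i)) \<le> d"
    unfolding comb_diam_le_def by blast
  then have "d < norm (S u - S v)" by (simp add: S_def scaleR_diff_right sum_subtractf)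
  also have "\<dots> \<le> norm (S u - p) + norm (S v - p)" by norm
  finally have "d / 2 \<le> norm (S u - p) \<or> d / 2 \<le> norm (S v - p)" by linarith
  with u v obtain w where w: "w \<in> Pi A V" "d / 2 \<le> norm (S w - p)" by blast
  obtain f :: "'a \<Rightarrow> real" where f: "bounded_linear f" "\<And>x. \<bar>f x\<bar> \<le> norm x" "f (S w - p) = norm (S w - p)"
    using norming_functional by blast
  interpret f: bounded_linear f by (rule f)
  \<comment> \<open>The losses \<open>g i * \<kappa>\<close> add up to at most \<open>d / 8\<close>,
    which leaves \<open>d / 2 - d / 8 = 3 * d / 8\<close>. The summand \<open>1\<close> keeps the
    denominator positive.\<close>
  define \<kappa> where "\<kappa> = d / 8 / (1 + sum g A)"
  have G: "0 \<le> sum g A" using g by (intro sum_nonneg)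
  have \<kappa>: "0 < \<kappa>" "sum g A * \<kappa> \<le> d / 8"
    using d G unfolding \<kappa>_def by (auto simp: field_simps)
  define V' where "V' i = V i \<inter> {y. f y > f (w i) - \<kappa>}" for i
  have "op (V' i) \<and> V' i \<subseteq> V i" if i: "i \<in> A" for i
  proof -
    have "w i \<in> V' i" using w(1) i \<kappa> by (auto simp: V'_def)
    then have "V i \<inter> {y. f y > f (w i) - \<kappa>} \<noteq> {}" unfolding V'_def by blast
    then show ?thesis using op_halfspace[OF op[OF i] f(1)] by (simp add: V'_def)
  qed
  moreover have "3 * d / 8 \<le> norm (S z - p)" if z: "z \<in> Pi A V'" for z
  proof -
    have "g i * f (w i) - g i * \<kappa> \<le> g i * f (z i)" if "i \<in> A" for i
    proof -
      have "z i \<in> V' i" using z that by (rule Pi_mem)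
      then have "f (w i) - \<kappa> \<le> f (z i)" by (simp add: V'_def)
      then have "g i * (f (w i) - \<kappa>) \<le> g i * f (z i)" using g[OF that] by (rule mult_left_mono)
      then show ?thesis by (simp add: right_diff_distrib)
    qed
    then have "(\<Sum>i\<in>A. g i * f (w i) - g i * \<kappa>) \<le> (\<Sum>i\<in>A. g i * f (z i))"
      by (rule sum_mono)
    then have "f (S w) - sum g A * \<kappa> \<le> f (S z)"
      by (simp add: S_def f.sum f.scaleR sum_subtractf sum_distrib_right)
    then have "f (S w - p) - d / 8 \<le> f (S z - p)" using \<kappa> by (simp add: f.diff)
    then show ?thesis using f(2)[of "S z - p"] f(3) w(2) by simp
  qed
  ultimately show ?thesis using that[of V'] unfolding far_or_small_def S_def by blast
qed

lemma shrink_finite_weights: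
  assumes "finite Q" "\<And>i. i \<in> A \<Longrightarrow> op (V i)" and d: "0 < d"
    and "\<And>g i. g \<in> Q \<Longrightarrow> i \<in> A \<Longrightarrow> 0 \<le> g i"
  shows "\<exists>V'. (\<forall>i\<in>A. op (V' i) \<and> V' i \<subseteq> V i) \<and> (\<forall>g\<in>Q. far_or_small A V' p d (3 * d / 8) g)"
  using assms(1,4)
proof (induction Q rule: finite_induct)
  case empty
  then show ?case using assms(2) by blast
next
  case (insert g Q)
  then obtain V1 where V1: "\<forall>i\<in>A. op (V1 i) \<and> V1 i \<subseteq> V i"
      "\<forall>g\<in>Q. far_or_small A V1 p d (3 * d / 8) g" by auto
  obtain V' where V': "\<And>i. i \<in> A \<Longrightarrow> op (V' i) \<and> V' i \<subseteq> V1 i"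
      "far_or_small A V' p d (3 * d / 8) g"
    using shrink_single_weight[of A V1 d g p] V1 d insert.prems by auto
  have "\<forall>g\<in>Q. far_or_small A V' p d (3 * d / 8) g"
    using V1(2) V'(1) far_or_small_subset by blast
  with V1(1) V' show ?case by (intro exI[of _ V']) blast
qed

text \<open>Only a finite grid of weights is treated; rounding moves a combination by at most
  \<open>d / 8\<close>. So a diameter \<open>d\<close> becomes at most
  \<open>d + 2 * (d / 8) \<le> 2 * d\<close>, and a distance \<open>3 * d / 8\<close> stays at least
  \<open>d / 4\<close>. Rounding spoils the total weight, so none is prescribed.\<close>

lemma shrink_all_weights:
  assumes A: "finite A" and op: "\<And>i. i \<in> A \<Longrightarrow> op (V i)" and d: "0 < d"
  shows "\<exists>V'. (\<forall>i\<in>A. op (V' i) \<and> V' i \<subseteq> V i) \<and>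
    (\<forall>c. (\<forall>i\<in>A. 0 \<le> c i \<and> c i \<le> 1) \<longrightarrow> far_or_small A V' p (2 * d) (d / 4) c)"
proof -
  \<comment> \<open>With mesh \<open>1 / q\<close>, each of the \<open>card A\<close> weights
    changes by at most \<open>1 / q\<close> in front of a vector of norm at most
    \<open>M\<close>.\<close>
  obtain q :: nat where q: "real (card A) * M * 8 / d < q" using reals_Archimedean2 by blast
  moreover have "0 \<le> real (card A) * M * 8 / d" using M_pos d by simp
  ultimately have q0: "0 < real q" by linarith
  have qd: "real (card A) / q * M \<le> d / 8" using q q0 d by (simp add: field_simps)
  define Q where "Q = PiE A (\<lambda>_. (\<lambda>k. real k / q) ` {..q})"
  have "finite Q" unfolding Q_def using A by (intro finite_PiE) auto
  moreover have "0 \<le> g i" if "g \<in> Q" "i \<in> A" for g i using that by (auto simp: Q_def PiE_iff)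
  ultimately obtain V' where V': "\<forall>i\<in>A. op (V' i) \<and> V' i \<subseteq> V i"
      "\<forall>g\<in>Q. far_or_small A V' p d (3 * d / 8) g"
    using shrink_finite_weights[of Q A V d p] op d by blast
  have "far_or_small A V' p (2 * d) (d / 4) c" if c: "\<forall>i\<in>A. 0 \<le> c i \<and> c i \<le> 1" for c
  proof -
    define g where "g = restrict (\<lambda>i. real (nat \<lfloor>c i * q\<rfloor>) / q) A"
    have gi: "real (nat \<lfloor>c i * q\<rfloor>) \<le> c i * q" "c i * q \<le> real (nat \<lfloor>c i * q\<rfloor>) + 1" "nat \<lfloor>c i * q\<rfloor> \<le> q"
      if "i \<in> A" for i
    proof -
      have "0 \<le> c i * q" "c i * q \<le> q" using c that q0 by (auto simp: mult_left_le_one_le)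
      then show "real (nat \<lfloor>c i * q\<rfloor>) \<le> c i * q" "c i * q \<le> real (nat \<lfloor>c i * q\<rfloor>) + 1" "nat \<lfloor>c i * q\<rfloor> \<le> q"
        by linarith+
    qed
    then have "g \<in> Q" unfolding Q_def g_def by auto
    have "\<bar>c i - g i\<bar> \<le> 1 / q" if "i \<in> A" for i
    proof -
      have "c i - g i = (c i * q - real (nat \<lfloor>c i * q\<rfloor>)) / q"
        using q0 that by (simp add: g_def diff_divide_distrib)
      moreover have "\<bar>c i * q - real (nat \<lfloor>c i * q\<rfloor>)\<bar> \<le> 1" using gi[OF that] by linarith
      ultimately show ?thesis using q0 by (simp add: abs_divide divide_right_mono)
    qed
    then have "(\<Sum>i\<in>A. \<bar>c i - g i\<bar>) \<le> (\<Sum>i\<in>A. 1 / q)" by (rule sum_mono)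
    then have "(\<Sum>i\<in>A. \<bar>c i - g i\<bar>) * M \<le> real (card A) / q * M"
      using M_pos by (intro mult_right_mono) auto
    then have close: "(\<Sum>i\<in>A. \<bar>c i - g i\<bar>) * M \<le> d / 8" using qd by linarith
    have bnd: "norm x \<le> M" if "i \<in> A" "x \<in> V' i" for i x using that V'(1) op_bounded by blast
    consider "comb_diam_le A V' g d" | "\<forall>u\<in>Pi A V'. 3 * d / 8 \<le> norm ((\<Sum>i\<in>A. g i *\<^sub>R u i) - p)"
      using V'(2) \<open>g \<in> Q\<close> unfolding far_or_small_def by blast
    then show ?thesis
    proof cases
      case 1
      have "comb_diam_le A V' c (d + 2 * (d / 8))"
        using M_pos bnd by (intro comb_diam_le_perturb[OF 1 _ _ close]) auto
      then have "comb_diam_le A V' c (2 * d)"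
        by (rule comb_diam_le_mono) (use d in simp)
      then show ?thesis unfolding far_or_small_def by blast
    next
      case 2
      have "d / 4 \<le> norm ((\<Sum>i\<in>A. c i *\<^sub>R u i) - p)" if u: "u \<in> Pi A V'" for u
      proof -
        have "norm ((\<Sum>i\<in>A. c i *\<^sub>R u i) - (\<Sum>i\<in>A. g i *\<^sub>R u i)) \<le> d / 8"
          using u bnd M_pos close by (intro order_trans[OF norm_comb_diff_weights[of A u M c g]]) auto
        moreover have "3 * d / 8 \<le> norm ((\<Sum>i\<in>A. g i *\<^sub>R u i) - p)" using 2 u by blast
        moreover have "d / 4 \<le> norm (y - p)"
          if "norm (y - x) \<le> d / 8" "3 * d / 8 \<le> norm (x - p)" for x y :: 'a
        proof -
          have "norm (x - p) \<le> norm (y - x) + norm (y - p)" by norm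
          with that show ?thesis by linarith
        qed
        ultimately show ?thesis by blast
      qed
      then show ?thesis unfolding far_or_small_def by blast
    qed
  qed
  with V'(1) show ?thesis by blast
qed

section \<open>Construction of the tree by successive refinement\<close>

definition admissible :: "nat list set \<times> (nat list \<Rightarrow> 'a set) \<times> (nat list \<Rightarrow> real) \<Rightarrow> bool" where
  "admissible = (\<lambda>(A, V, l). finite A \<and> (\<forall>\<alpha>\<in>A. op (V \<alpha>) \<and> 0 \<le> l \<alpha>) \<and> sum l A = 1)"

text \<open>Stage \<open>n\<close> treats the ball with radius \<open>1 / (4 (j + 1))\<close> around \<open>b k\<close>,
  where \<open>n\<close> encodes \<open>(j, k)\<close>.\<close>

definition refines :: "nat \<Rightarrow> nat list set \<times> (nat list \<Rightarrow> 'a set) \<times> (nat list \<Rightarrow> real) \<Rightarrow>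
    nat list set \<times> (nat list \<Rightarrow> 'a set) \<times> (nat list \<Rightarrow> real) \<Rightarrow> bool" where
  "refines n = (\<lambda>(A, V, l) (A', V', l').
     (\<forall>\<beta>\<in>A'. tl \<beta> \<in> A \<and> V' \<beta> \<subseteq> V (tl \<beta>)) \<and>
     (\<forall>\<alpha>\<in>A. l \<alpha> = (\<Sum>\<beta> | \<beta> \<in> A' \<and> tl \<beta> = \<alpha>. l' \<beta>)) \<and>
     comb_diam_le A' V' l' (1 / Suc n) \<and>
     (\<forall>c. (\<forall>\<beta>\<in>A'. 0 \<le> c \<beta> \<and> c \<beta> \<le> 1) \<longrightarrow>
       far_or_small A' V' (b (snd (prod_decode n)))
         (2 / Suc (fst (prod_decode n))) (1 / Suc (fst (prod_decode n)) / 4) c))"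

text \<open>\<open>op_comb\<close> splits every node into sets with a combination of diameter at
  most \<open>\<eta>\<close>. With product weights the diameters on the new level add up to at most
  \<open>\<Sum> l \<alpha> * \<eta> = \<eta>\<close>, and this survives the subsequent shrinking
  that deals with the ball.\<close>

lemma refinement_exists:
  assumes "admissible s"
  shows "\<exists>s'. admissible s' \<and> refines n s s'"
proof -
  obtain A V l where s: "s = (A, V, l)" by (cases s)
  have A: "finite A" and V: "\<And>\<alpha>. \<alpha> \<in> A \<Longrightarrow> op (V \<alpha>)" and l: "\<And>\<alpha>. \<alpha> \<in> A \<Longrightarrow> 0 \<le> l \<alpha>"
    and l1: "sum l A = 1"
    using assms unfolding s admissible_def by auto
  define \<eta> :: real where "\<eta> = 1 / Suc n"
  have \<eta>: "0 < \<eta>" by (simp add: \<eta>_def)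
  have "\<forall>\<alpha>\<in>A. \<exists>(N::nat) m W. (\<forall>i<N. 0 \<le> m i) \<and> (\<Sum>i<N. m i) = 1 \<and>
      (\<forall>i<N. op (W i) \<and> W i \<subseteq> V \<alpha>) \<and> comb_diam_le {..<N} W m \<eta>"
    by (intro ballI op_comb V \<eta>)
  then obtain N :: "nat list \<Rightarrow> nat" and m W
    where H: "\<forall>\<alpha>\<in>A. (\<forall>i<N \<alpha>. 0 \<le> m \<alpha> i) \<and> (\<Sum>i<N \<alpha>. m \<alpha> i) = 1 \<and>
      (\<forall>i<N \<alpha>. op (W \<alpha> i) \<and> W \<alpha> i \<subseteq> V \<alpha>) \<and> comb_diam_le {..<N \<alpha>} (W \<alpha>) (m \<alpha>) \<eta>"
    unfolding bchoice_iff by blast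
  have m: "0 \<le> m \<alpha> i" and W: "op (W \<alpha> i) \<and> W \<alpha> i \<subseteq> V \<alpha>" if "\<alpha> \<in> A" "i < N \<alpha>" for \<alpha> i
    using H that by blast+
  have m1: "(\<Sum>i<N \<alpha>. m \<alpha> i) = 1" and Wd: "comb_diam_le {..<N \<alpha>} (W \<alpha>) (m \<alpha>) \<eta>"
    if "\<alpha> \<in> A" for \<alpha>
    using H that by blast+
  \<comment> \<open>Prefixing the index to the parent keeps children of different parents apart;
    \<open>tl\<close> returns the parent and \<open>hd\<close> the index.\<close>
  define A' where "A' = (\<Union>\<alpha>\<in>A. (\<lambda>j. j # \<alpha>) ` {..<N \<alpha>})"
  define W' where "W' \<beta> = W (tl \<beta>) (hd \<beta>)" for \<beta>
  define l' where "l' \<beta> = l (tl \<beta>) * m (tl \<beta>) (hd \<beta>)" for \<beta>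
  have A'fin: "finite A'" using A by (simp add: A'_def)
  have A'E: "tl \<beta> \<in> A \<and> hd \<beta> < N (tl \<beta>)" if "\<beta> \<in> A'" for \<beta> using that by (auto simp: A'_def)
  have "op (W' \<beta>)" if "\<beta> \<in> A'" for \<beta> using A'E[OF that] W by (simp add: W'_def)
  then obtain V' where V': "\<forall>\<beta>\<in>A'. op (V' \<beta>) \<and> V' \<beta> \<subseteq> W' \<beta>"
    and far: "\<forall>c. (\<forall>\<beta>\<in>A'. 0 \<le> c \<beta> \<and> c \<beta> \<le> 1) \<longrightarrow>
       far_or_small A' V' (b (snd (prod_decode n)))
         (2 * (1 / Suc (fst (prod_decode n)))) (1 / Suc (fst (prod_decode n)) / 4) c"
    using shrink_all_weights[OF A'fin, of W' "1 / Suc (fst (prod_decode n))" "b (snd (prod_decode n))"]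
    by auto
  have ch: "{\<beta>. \<beta> \<in> A' \<and> tl \<beta> = \<alpha>} = (\<lambda>j. j # \<alpha>) ` {..<N \<alpha>}" if "\<alpha> \<in> A" for \<alpha>
    using that by (auto simp: A'_def)
  have sum_ch: "(\<Sum>\<beta> | \<beta> \<in> A' \<and> tl \<beta> = \<alpha>. h \<beta>) = (\<Sum>j<N \<alpha>. h (j # \<alpha>))" if "\<alpha> \<in> A"
    for \<alpha> and h :: "nat list \<Rightarrow> 'c::comm_monoid_add"
    unfolding ch[OF that] by (subst sum.reindex) (auto simp: inj_on_def)
  have sum_A': "sum h A' = (\<Sum>\<alpha>\<in>A. \<Sum>j<N \<alpha>. h (j # \<alpha>))" for h :: "nat list \<Rightarrow> 'c::comm_monoid_add"
  proof -
    have "sum h A' = (\<Sum>\<alpha>\<in>A. \<Sum>\<beta> | \<beta> \<in> A' \<and> tl \<beta> = \<alpha>. h \<beta>)"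
      using A'E by (intro sum.group[symmetric] A A'fin) auto
    also have "\<dots> = (\<Sum>\<alpha>\<in>A. \<Sum>j<N \<alpha>. h (j # \<alpha>))" by (intro sum.cong refl sum_ch)
    finally show ?thesis .
  qed
  have l_sum: "l \<alpha> = (\<Sum>j<N \<alpha>. l' (j # \<alpha>))" if "\<alpha> \<in> A" for \<alpha>
    using m1[OF that] by (simp add: l'_def flip: sum_distrib_left)
  have "comb_diam_le A' W' l' \<eta>"
    unfolding comb_diam_le_def
  proof (intro ballI)
    fix u v assume u: "u \<in> Pi A' W'" and v: "v \<in> Pi A' W'"
    have "norm (\<Sum>j<N \<alpha>. l' (j # \<alpha>) *\<^sub>R (u (j # \<alpha>) - v (j # \<alpha>))) \<le> l \<alpha> * \<eta>" if \<alpha>: "\<alpha> \<in> A" for \<alpha>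
    proof -
      have uv: "(\<lambda>j. u (j # \<alpha>)) \<in> Pi {..<N \<alpha>} (W \<alpha>)" "(\<lambda>j. v (j # \<alpha>)) \<in> Pi {..<N \<alpha>} (W \<alpha>)"
        using u v \<alpha> by (auto simp: A'_def W'_def Pi_iff)
      have "norm (\<Sum>j<N \<alpha>. m \<alpha> j *\<^sub>R (u (j # \<alpha>) - v (j # \<alpha>))) \<le> \<eta>"
        by (rule Wd[OF \<alpha>, unfolded comb_diam_le_def, rule_format, OF uv])
      then have "l \<alpha> * norm (\<Sum>j<N \<alpha>. m \<alpha> j *\<^sub>R (u (j # \<alpha>) - v (j # \<alpha>))) \<le> l \<alpha> * \<eta>"
        using l[OF \<alpha>] by (rule mult_left_mono)
      moreover have "(\<Sum>j<N \<alpha>. l' (j # \<alpha>) *\<^sub>R (u (j # \<alpha>) - v (j # \<alpha>))) =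
          l \<alpha> *\<^sub>R (\<Sum>j<N \<alpha>. m \<alpha> j *\<^sub>R (u (j # \<alpha>) - v (j # \<alpha>)))"
        by (simp add: l'_def scaleR_sum_right)
      ultimately show ?thesis using l[OF \<alpha>] by simp
    qed
    then have "norm (\<Sum>\<beta>\<in>A'. l' \<beta> *\<^sub>R (u \<beta> - v \<beta>)) \<le> (\<Sum>\<alpha>\<in>A. l \<alpha> * \<eta>)"
      unfolding sum_A' by (rule sum_norm_le)
    then show "norm (\<Sum>\<beta>\<in>A'. l' \<beta> *\<^sub>R (u \<beta> - v \<beta>)) \<le> \<eta>"
      using l1 by (simp flip: sum_distrib_right)
  qed
  then have "comb_diam_le A' V' l' \<eta>" by (rule comb_diam_le_subset) (use V' in blast)
  moreover have "\<forall>\<beta>\<in>A'. tl \<beta> \<in> A \<and> V' \<beta> \<subseteq> V (tl \<beta>)"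
  proof
    fix \<beta> assume \<beta>: "\<beta> \<in> A'"
    with V' have "V' \<beta> \<subseteq> W (tl \<beta>) (hd \<beta>)" unfolding W'_def by blast
    with A'E[OF \<beta>] W[of "tl \<beta>" "hd \<beta>"] show "tl \<beta> \<in> A \<and> V' \<beta> \<subseteq> V (tl \<beta>)" by blast
  qed
  moreover have "\<forall>\<alpha>\<in>A. l \<alpha> = (\<Sum>\<beta> | \<beta> \<in> A' \<and> tl \<beta> = \<alpha>. l' \<beta>)"
    by (intro ballI) (simp only: sum_ch, rule l_sum)
  ultimately have "refines n s (A', V', l')"
    using far unfolding s refines_def \<eta>_def by simp
  moreover have "sum l' A' = 1" unfolding sum_A' using l_sum l1 by simp
  then have "admissible (A', V', l')"
    using A'fin V' A'E l m unfolding admissible_def by (simp add: l'_def)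
  ultimately show ?thesis by blast
qed

text \<open>The required set is the \<open>core\<close> of a tree grown from the single node
  \<open>[]\<close> carrying \<open>C\<close>. The weights \<open>l\<close> show that it is
  nonempty, and level \<open>0\<close> places it in \<open>closure C\<close>.\<close>

proposition closed_convex_without_extreme_points:
  assumes "op C"
  obtains K where "K \<noteq> {}" "closed K" "convex K" "K \<subseteq> closure C" "\<nexists>x. x extreme_point_of K"
proof -
  define s0 where "s0 = ({[] :: nat list}, \<lambda>_ :: nat list. C, \<lambda>_ :: nat list. 1 :: real)"
  \<comment> \<open>The clause for \<open>n = 0\<close> fixes the start of the sequence within
    dependent choice.\<close>
  have "\<exists>s. \<forall>n. (admissible (s n) \<and> (n = 0 \<longrightarrow> s n = s0)) \<and> refines n (s n) (s (Suc n))"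
  proof (rule dependent_nat_choice)
    show "\<exists>x. admissible x \<and> (0 = (0::nat) \<longrightarrow> x = s0)"
      using assms unfolding admissible_def s0_def by auto
  qed (use refinement_exists in auto)
  then obtain s where adm: "\<And>n. admissible (s n)" and start: "s 0 = s0"
    and ref: "\<And>n. refines n (s n) (s (Suc n))" by blast
  define I U l where "I n = fst (s n)" and "U n = fst (snd (s n))" and "l n = snd (snd (s n))" for n
  have s: "s n = (I n, U n, l n)" for n by (simp add: I_def U_def l_def)
  have op: "op (U n \<alpha>)" if "\<alpha> \<in> I n" for n \<alpha>
    using adm[of n] that unfolding s admissible_def by auto
  have fin: "finite (I n)" and l_nonneg: "\<alpha> \<in> I n \<Longrightarrow> 0 \<le> l n \<alpha>" and l_one: "sum (l n) (I n) = 1"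
    for n \<alpha>
    using adm[of n] unfolding s admissible_def by auto
  have par: "tl \<beta> \<in> I n \<and> U (Suc n) \<beta> \<subseteq> U n (tl \<beta>)" if "\<beta> \<in> I (Suc n)" for n \<beta>
    using ref[of n] that unfolding s refines_def by auto
  have l_coh: "\<forall>\<alpha>\<in>I n. l n \<alpha> = (\<Sum>\<beta> | \<beta> \<in> I (Suc n) \<and> tl \<beta> = \<alpha>. l (Suc n) \<beta>)"
    and l_small: "comb_diam_le (I (Suc n)) (U (Suc n)) (l (Suc n)) (1 / Suc n)" for n
    using ref[of n] unfolding s refines_def by auto
  have far: "far_or_small (I (Suc n)) (U (Suc n)) (b k) (2 / Suc j) (1 / Suc j / 4) c"
    if "n = prod_encode (j, k)" "\<And>\<beta>. \<beta> \<in> I (Suc n) \<Longrightarrow> 0 \<le> c \<beta> \<and> c \<beta> \<le> 1" for n j k c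
    using ref[of n] that unfolding s refines_def by auto
  interpret convex_tree I U M
  proof
    show "convex (U n \<alpha>)" "U n \<alpha> \<noteq> {}" if "\<alpha> \<in> I n" for n \<alpha>
      using op[OF that] op_convex op_nonempty by blast+
    show "norm x \<le> M" if "\<alpha> \<in> I n" "x \<in> U n \<alpha>" for n \<alpha> x
      using op[OF that(1)] op_bounded that(2) by blast
    show "tl \<beta> \<in> I n" "U (Suc n) \<beta> \<subseteq> U n (tl \<beta>)" if "\<beta> \<in> I (Suc n)" for n \<beta>
      using par[OF that] by blast+
  qed (use fin M_pos in auto)
  \<comment> \<open>The ball around \<open>b k\<close> contains \<open>x\<close>, and combinations
    come arbitrarily close to \<open>x\<close>, so they cannot all avoid the ball. This serves
    twice: for the weights of \<open>x\<close> and for a unit weight.\<close>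
  have small_if_near: "comb_diam_le (I (Suc n)) (U (Suc n)) (c (Suc n)) (2 / Suc j)"
    if n: "n = prod_encode (j, k)" and x: "dist x (b k) < 1 / Suc j / 4"
      and c: "\<And>\<beta>. \<beta> \<in> I (Suc n) \<Longrightarrow> 0 \<le> c (Suc n) \<beta> \<and> c (Suc n) \<beta> \<le> 1"
      and near: "x \<in> closure (combs c (Suc n))" for x j k n c
  proof (rule ccontr)
    assume "\<not> ?thesis"
    then have *: "\<forall>u\<in>Pi (I (Suc n)) (U (Suc n)).
        1 / Suc j / 4 \<le> norm ((\<Sum>\<beta>\<in>I (Suc n). c (Suc n) \<beta> *\<^sub>R u \<beta>) - b k)"
      using far[OF n, of "c (Suc n)", OF c] unfolding far_or_small_def by blast
    have "0 < 1 / Suc j / 4 - dist x (b k)" using x by simp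
    then obtain y where y: "y \<in> combs c (Suc n)" "dist y x < 1 / Suc j / 4 - dist x (b k)"
      using near closure_approachable by blast
    then have "1 / Suc j / 4 \<le> dist y (b k)" using * unfolding combs_def dist_norm by auto
    then show False using y(2) dist_triangle[of y "b k" x] by simp
  qed
  have "core \<noteq> {}"
  proof -
    have coh: "coherent n l" for n using l_coh unfolding coherent_def by blast
    have "\<exists>m\<ge>0. comb_diam_le (I m) (U m) (l m) e" if e: "0 < e" for e
    proof -
      obtain n where n: "1 / Suc n < e" using nat_approx_posE[OF e] by blast
      have "comb_diam_le (I (Suc n)) (U (Suc n)) (l (Suc n)) e"
        by (rule comb_diam_le_mono[OF l_small less_imp_le[OF n]])
      then show ?thesis by blast
    qed
    then have "\<exists>t. (\<Inter>m\<in>{0..}. closure (combs l m)) = {t}"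
      using coh l_nonneg by (intro coherent_combs_limit) auto
    then obtain t where t: "\<And>m. t \<in> closure (combs l m)" by force
    have "t \<in> closure (hull_level n)" for n
      using t[of n] closure_mono[OF combs_subset_hull_level[of n l]] l_nonneg l_one by auto
    then show ?thesis unfolding core_def by blast
  qed
  moreover have "core \<subseteq> closure C"
  proof -
    have "hull_level 0 = C"
      using op_convex[OF assms] start by (simp add: hull_level_def I_def U_def s0_def convex_hull_eq)
    then show ?thesis unfolding core_def by blast
  qed
  moreover have "\<nexists>x. x extreme_point_of core"
  proof
    assume "\<exists>x. x extreme_point_of core"
    then obtain x where ext: "x extreme_point_of core" ..
    then have "x \<in> core" unfolding extreme_point_of_def by blast
    then obtain c where coh: "\<And>n. coherent n c" and nonneg: "\<And>n \<alpha>. \<alpha> \<in> I n \<Longrightarrow> 0 \<le> c n \<alpha>"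
      and one: "\<And>n. (\<Sum>\<alpha>\<in>I n. c n \<alpha>) = 1" and near: "\<And>n. x \<in> closure (combs c n)"
      using core_coherent_weights by blast
    have c01: "0 \<le> c n \<alpha> \<and> c n \<alpha> \<le> 1" if "\<alpha> \<in> I n" for n \<alpha>
      using member_le_sum[of \<alpha> "I n" "c n"] that nonneg fin one[of n] by auto
    have near_ball: "\<exists>k. dist x (b k) < 1 / Suc j / 4" for j by (rule dense) simp
    have small: "\<exists>m\<ge>m0. comb_diam_le (I m) (U m) (c m) e" if e: "0 < e" for e m0
    proof -
      obtain j0 where j0: "1 / Suc j0 < e / 2" using nat_approx_posE[of "e / 2"] e by auto
      \<comment> \<open>\<open>j \<ge> j0\<close> makes the diameter small, while
        \<open>j \<ge> m0\<close> makes the level large enough, since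
        \<open>prod_encode (j, k) \<ge> j\<close>.\<close>
      define j where "j = max j0 m0"
      have "1 / real (Suc j) \<le> 1 / Suc j0" by (simp add: j_def frac_le)
      then have j: "2 / real (Suc j) \<le> e" using j0 by simp
      obtain k where k: "dist x (b k) < 1 / Suc j / 4" using near_ball by blast
      define n where "n = prod_encode (j, k)"
      have "comb_diam_le (I (Suc n)) (U (Suc n)) (c (Suc n)) (2 / Suc j)"
        using small_if_near[OF n_def k] c01 near by blast
      then have "comb_diam_le (I (Suc n)) (U (Suc n)) (c (Suc n)) e"
        using j by (rule comb_diam_le_mono)
      moreover have "m0 \<le> Suc n"
        using le_prod_encode_1[of j k] by (simp add: n_def j_def)
      ultimately show ?thesis by blast
    qed
    \<comment> \<open>At this scale \<open>2 / Suc j < \<epsilon>\<close>, so a node of level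
      \<open>Suc n\<close> is too wide to count as small.\<close>
    obtain j where j: "1 / Suc j < \<epsilon> / 2" using nat_approx_posE[of "\<epsilon> / 2"] \<epsilon>_pos by auto
    obtain k where k: "dist x (b k) < 1 / Suc j / 4" using near_ball by blast
    define n where "n = prod_encode (j, k)"
    obtain \<alpha> where \<alpha>: "\<alpha> \<in> I (Suc n)" "0 < c (Suc n) \<alpha>"
    proof -
      have "\<not> (\<forall>\<alpha>\<in>I (Suc n). c (Suc n) \<alpha> \<le> 0)"
        using one[of "Suc n"] sum_nonpos[of "I (Suc n)" "c (Suc n)"] by fastforce
      then show thesis using that by (auto simp: not_le)
    qed
    have x_node: "x \<in> closure (U (Suc n) \<alpha>)"
      by (rule extreme_point_in_closure_node[OF ext coh nonneg one near small \<alpha>])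
    \<comment> \<open>The combinations for the unit weight at \<open>\<alpha>\<close> are the points
      of the node, whose closure contains \<open>x\<close>; so the node would have to be
      small.\<close>
    define g where "g m \<beta> = (if \<beta> = \<alpha> then 1 else 0 :: real)" for m :: nat and \<beta>
    have g_sum: "(\<Sum>\<beta>\<in>I (Suc n). g (Suc n) \<beta> *\<^sub>R v \<beta>) = v \<alpha>" for v :: "nat list \<Rightarrow> 'a"
      using \<alpha>(1) fin by (simp add: g_def if_distrib[of "\<lambda>t. t *\<^sub>R _"] cong: if_cong)
    obtain t where t: "t \<in> Pi (I (Suc n)) (U (Suc n))" by (rule selection_exists)
    have upd: "t(\<alpha> := y) \<in> Pi (I (Suc n)) (U (Suc n))" if "y \<in> U (Suc n) \<alpha>" for y
      using t that by auto
    have "U (Suc n) \<alpha> \<subseteq> combs g (Suc n)"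
    proof
      fix y assume "y \<in> U (Suc n) \<alpha>"
      then show "y \<in> combs g (Suc n)"
        unfolding combs_def g_sum using upd by (intro image_eqI[of _ _ "t(\<alpha> := y)"]) auto
    qed
    then have "x \<in> closure (combs g (Suc n))" using x_node closure_mono by blast
    then have diam: "comb_diam_le (I (Suc n)) (U (Suc n)) (g (Suc n)) (2 / Suc j)"
      by (rule small_if_near[OF n_def k, rotated]) (simp add: g_def)
    obtain y z where yz: "y \<in> U (Suc n) \<alpha>" "z \<in> U (Suc n) \<alpha>" "\<epsilon> < norm (y - z)"
      using op_wide[OF op[OF \<alpha>(1)]] by blast
    have "norm (y - z) \<le> 2 / Suc j"
      using comb_diam_leD[OF diam upd[OF yz(1)] upd[OF yz(2)]] unfolding g_sum by simp
    then show False using yz(3) j by simp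
  qed
  ultimately show thesis using that closed_core convex_core by blast
qed

end

section \<open>From the topology to the family of convex open sets\<close>

theorem theorem2p6:
  fixes D :: "'a::banach set" and \<tau> :: "'a topology"
  assumes "separable_space (euclidean :: 'a topology)"
    and "closed D" and "bounded D" and "convex D"
    and "topspace \<tau> = D"
    and "locally_convex_top \<tau>"
    and "\<forall>S. openin (weak_topology_on D) S \<longrightarrow> openin \<tau> S"
    and "tau_strongly_regular \<tau> D"
    and "\<not> tau_CPCP \<tau> D"
  shows "\<exists>K. K \<subseteq> D \<and> K \<noteq> {} \<and> closed K \<and> convex K \<and> \<not> (\<exists>x. x extreme_point_of K)"
proof -
  from assms(9) obtain C \<epsilon> where C: "C \<subseteq> D" "C \<noteq> {}" "bounded C" "convex C" and \<epsilon>: "0 < \<epsilon>"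
    and wide: "\<And>V. openin (subtopology \<tau> C) V \<Longrightarrow> V \<noteq> {} \<Longrightarrow> \<epsilon> \<le> diameter V"
    unfolding tau_CPCP_def by (auto simp: not_less)
  obtain M where M: "0 < M" "\<And>x. x \<in> D \<Longrightarrow> norm x \<le> M"
    using assms(3) unfolding bounded_pos by blast
  from assms(1) obtain Q :: "'a set" where Q: "countable Q" "closure Q = UNIV"
    unfolding separable_space_def by auto
  have dense: "\<exists>k. dist x (from_nat_into Q k) < e" if e: "0 < e" for x e
  proof -
    have "x \<in> closure Q" using Q(2) by simp
    then obtain y where "y \<in> Q" "dist y x < e" using e closure_approachable by blast
    moreover obtain k where "from_nat_into Q k = y"
      using from_nat_into_surj[OF Q(1) \<open>y \<in> Q\<close>] by blast
    ultimately show ?thesis by (auto simp: dist_commute)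
  qed
  define op where "op V \<longleftrightarrow> V \<noteq> {} \<and> convex V \<and> openin (subtopology \<tau> C) V" for V
  have op_open: "openin (subtopology \<tau> C) V" if "op V" for V using that unfolding op_def by blast
  have op_C: "V \<subseteq> C" if "op V" for V
    using that openin_subset unfolding op_def by fastforce
  have op_D: "V \<subseteq> D" if "op V" for V using op_C[OF that] C(1) by blast
  \<comment> \<open>Only \<open>\<epsilon> \<le> diameter V\<close> is known and the supremum need
    not be attained; half of \<open>\<epsilon>\<close> is exceeded by an actual pair of
    points.\<close>
  interpret wide_open_sets op M "\<epsilon> / 2" "from_nat_into Q"
  proof
    show "norm x \<le> M" if "op V" "x \<in> V" for V x using that op_D M(2) by blast
  next
    fix V and f :: "'a \<Rightarrow> real" and r
    assume V: "op V" and f: "bounded_linear f" and ne: "V \<inter> {y. f y > r} \<noteq> {}"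
    \<comment> \<open>Open half-spaces are weakly open; this is where \<open>\<tau>\<close> has to
      contain the weak topology.\<close>
    have "D \<inter> f -` {r<..} \<in> {D \<inter> f -` U | f U. bounded_linear (f :: 'a \<Rightarrow> real) \<and> open U}"
      using f open_greaterThan by blast
    then have "openin (weak_topology_on D) (D \<inter> f -` {r<..})"
      unfolding weak_topology_on_def by (rule topology_generated_by_Basis)
    then have "openin \<tau> (D \<inter> f -` {r<..})" using assms(7) by blast
    then have "openin (subtopology \<tau> C) (C \<inter> (D \<inter> f -` {r<..}))" by (rule openin_subtopology_Int2)
    then have "openin (subtopology \<tau> C) (V \<inter> (C \<inter> (D \<inter> f -` {r<..})))"
      by (rule openin_Int[OF op_open[OF V]])
    moreover have "V \<inter> (C \<inter> (D \<inter> f -` {r<..})) = V \<inter> {y. f y > r}"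
      using op_C[OF V] C(1) by auto
    moreover have "convex {y. f y > r}"
    proof -
      interpret bounded_linear f by (rule f)
      have "convex (f -` {r<..})" by (intro convex_linear_vimage linear_axioms) simp
      then show ?thesis by (simp add: vimage_def)
    qed
    ultimately show "op (V \<inter> {y. f y > r})"
      using V ne unfolding op_def by (auto intro: convex_Int)
  next
    fix V and \<eta> :: real assume V: "op V" and \<eta>: "0 < \<eta>"
    have bV: "bounded V" using op_D[OF V] assms(3) bounded_subset by blast
    have "V \<subseteq> D \<and> V \<noteq> {} \<and> bounded V \<and> convex V" using V op_D bV unfolding op_def by blast
    with assms(8) \<eta> obtain n l W where l: "\<forall>i<n. 0 \<le> l i" "(\<Sum>i<n. l i) = 1"
      and W: "\<forall>i<n. openin (subtopology \<tau> V) (W i) \<and> W i \<noteq> {}"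
      and diam: "diameter (convex_comb_sets n l W) < \<eta>"
      unfolding tau_strongly_regular_def by metis
    \<comment> \<open>The sets given by strong regularity need not be convex, but local convexity of
      \<open>\<tau>\<close> provides convex ones inside. They are open relative to \<open>C\<close>
      because \<open>V\<close> is.\<close>
    have "\<forall>i<n. \<exists>W'. op W' \<and> W' \<subseteq> W i"
    proof (intro allI impI)
      fix i assume "i < n"
      with W obtain T x where T: "openin \<tau> T" "W i = T \<inter> V" and x: "x \<in> W i"
        unfolding openin_subtopology by blast
      then obtain T' where T': "openin \<tau> T'" "convex T'" "x \<in> T'" "T' \<subseteq> T"
        using assms(6) unfolding locally_convex_top_def by blast
      have "openin (subtopology \<tau> C) (C \<inter> T')" using T'(1) by (rule openin_subtopology_Int2)
      then have "openin (subtopology \<tau> C) (V \<inter> (C \<inter> T'))"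
        by (rule openin_Int[OF op_open[OF V]])
      moreover have "V \<inter> (C \<inter> T') = V \<inter> T'" using op_C[OF V] by blast
      ultimately have "op (V \<inter> T')"
        using V x T T' unfolding op_def by (auto intro: convex_Int)
      then show "\<exists>W'. op W' \<and> W' \<subseteq> W i" using T T' by blast
    qed
    then obtain W' where W': "\<And>i. i < n \<Longrightarrow> op (W' i) \<and> W' i \<subseteq> W i" by metis
    have WV: "W i \<subseteq> V" if "i < n" for i
      using W that openin_subset by (fastforce simp: openin_subtopology)
    \<comment> \<open>Boundedness is what allows \<open>diameter\<close> to control the distance of
      two points.\<close>
    have "convex_comb_sets n l W \<subseteq> V"
    proof
      fix y assume "y \<in> convex_comb_sets n l W"
      then obtain x where "y = (\<Sum>i<n. l i *\<^sub>R x i)" "\<forall>i<n. x i \<in> W i"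
        unfolding convex_comb_sets_def by blast
      then show "y \<in> V" using l V WV unfolding op_def by (auto intro!: convex_sum)
    qed
    then have bnd: "bounded (convex_comb_sets n l W)" using bV bounded_subset by blast
    have "comb_diam_le {..<n} W' l \<eta>"
      unfolding comb_diam_le_def
    proof (intro ballI)
      fix u v assume "u \<in> Pi {..<n} W'" "v \<in> Pi {..<n} W'"
      then have "(\<Sum>i<n. l i *\<^sub>R u i) \<in> convex_comb_sets n l W" "(\<Sum>i<n. l i *\<^sub>R v i) \<in> convex_comb_sets n l W"
        using W' unfolding convex_comb_sets_def by (blast dest: Pi_mem)+
      then have "dist (\<Sum>i<n. l i *\<^sub>R u i) (\<Sum>i<n. l i *\<^sub>R v i) \<le> \<eta>"
        using diameter_bounded_bound[OF bnd] diam by fastforce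
      then show "norm (\<Sum>i<n. l i *\<^sub>R (u i - v i)) \<le> \<eta>"
        by (simp add: dist_norm scaleR_diff_right sum_subtractf)
    qed
    moreover have "\<forall>i<n. op (W' i) \<and> W' i \<subseteq> V" using W' WV by blast
    ultimately show "\<exists>(n::nat) l W. (\<forall>i<n. 0 \<le> l i) \<and> (\<Sum>i<n. l i) = 1 \<and>
        (\<forall>i<n. op (W i) \<and> W i \<subseteq> V) \<and> comb_diam_le {..<n} W l \<eta>"
      using l by blast
  next
    fix V assume V: "op V"
    then have "\<epsilon> / 2 < diameter V" using wide[of V] \<epsilon> unfolding op_def by auto
    moreover have "bounded V" using op_D[OF V] assms(3) bounded_subset by blast
    ultimately show "\<exists>u\<in>V. \<exists>v\<in>V. \<epsilon> / 2 < norm (u - v)"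
      using diameter_lower_bounded[of V "\<epsilon> / 2"] \<epsilon> by (auto simp: dist_norm)
  qed (use M \<epsilon> dense in \<open>auto simp: op_def\<close>)
  have "op C"
    using C assms(5) openin_topspace[of "subtopology \<tau> C"] unfolding op_def by (simp add: Int_absorb1)
  then obtain K where "K \<noteq> {}" "closed K" "convex K" "K \<subseteq> closure C" "\<nexists>x. x extreme_point_of K"
    using closed_convex_without_extreme_points by blast
  moreover have "closure C \<subseteq> D" using C(1) assms(2) by (rule closure_minimal)
  ultimately show ?thesis by blast
qed

end
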